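(* Let $(M,d)$, $\mu$, the Markov processes $(X_t)$, $(\widehat X_t)$ with semigroups $\{P_t\}$, $\{\widehat P_t\}$, the potential $V$, and the Feynman–Kac semigroups $\{U_t\}$, $\{U_t^*\}$ be as described in the context. For $x\in M$ and $t>0$, $$e^{-t\,\operatorname{ess\,sup}_y(\mathbf 1_{B_1(x)}(y)V_+(y))}\ \mathbb P^x(t\le\tau_{B_1(x)})\ \le\ U_t\mathbf 1(x)\ \le\ \frac1t\int_0^tP_s\big(e^{-tV(\cdot)}\big)(x)\,ds$$ (and similarly for $U_t^*\mathbf 1(x)$ with $X$, $P_s$, $\mathbb P^x$ replaced by $\widehat X$, $\widehat P_s$, $\widehat{\mathbb P}^x$). In particular, for $t>0$, $$\inf_{x\in M}\mathbb P^x(t\le\tau_{B_1(x)})\int_Me^{-t\,\operatorname{ess\,sup}_y(\mathbf 1_{B_1(x)}(y)V_+(y))}\,\mu(dx)\ \le\ Z(t)\ \le\ \int_Me^{-tV(x)}\,\mu(dx).$$ Consequently: (a) If $\lim_{d(x,x_0)\to\infty}V(x)=\infty$ (for some $x_0\in M$), then the operators $U_t,U_t^*$, $t>0$, are compact on $L^2(M,\mu)$. (b) Fix $t>0$. Then $\int_Me^{-tV(x)}\mu(dx)<\infty$ implies $Z(t)<\infty$. On the other hand, if $\inf_{x\in M}\mathbb P^x(t\le\tau_{B_1(x)})>0$, then $Z(t)<\infty$ implies $\int_Me^{-t\,\operatorname{ess\,sup}_y(\mathbf 1_{B_1(x)}(y)V_+(y))}\mu(dx)<\infty$.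
   Context: $(M,d)$ is an unbounded (in particular, not compact) locally compact Polish (complete separable metric) space; $\mu$ is a positive, locally finite, infinite Borel measure with full topological support. $(X_t)_{t\ge0}$ and $(\widehat X_t)_{t\ge0}$ are Markov processes in $M$ with transition semigroups $P_tf(x)=\mathbb E^xf(X_t)$, $\widehat P_tf(y)=\widehat{\mathbb E}^yf(\widehat X_t)$. It is assumed that: $P_t,\widehat P_t$ are contractions on $L^2(M,\mu)$; both semigroups are Feller (strongly continuous contraction semigroups mapping $C_\infty(M)$, the continuous functions vanishing at infinity, into itself) and strong Feller (mapping $L^\infty(M,\mu)$ into $C_b(M)$ for $t>0$); their resolvents are in weak duality with respect to $\mu$, so that $\int f\,P_tg\,d\mu=\int\widehat P_tf\,g\,d\mu$ for $f,g\in L^2(M,\mu)$, $t>0$; and for every $t>0$ the operators $P_t,\widehat P_t$ are positivity improving ($0\le f\not\equiv0$ in $L^2$ gives $P_tf>0$ a.e., and likewise for $\widehat P_t$) and bounded from $L^2(M,\mu)$ to $L^\infty(M,\mu)$. The potential $V=V_+-V_-$ is locally bounded and bounded below: $V_+\in L^\infty_{\mathrm{loc}}(M,\mu)$, $V_-\in L^\infty(M,\mu)$ ($V_\pm$ the positive and negative parts). The Feynman–Kac semigroup is $U_tf(x)=\mathbb E^x[e^{-\int_0^tV(X_s)ds}f(X_t)]$, and its adjoint in $L^2(M,\mu)$ is $U_t^*f(x)=\widehat{\mathbb E}^x[e^{-\int_0^tV(\widehat X_s)ds}f(\widehat X_t)]$. $B_1(x)$ is the ball of radius $1$ centred at $x$;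 $\tau_B:=\inf\{t>0:X_t\in M\setminus B\}$ is the first exit time (for $\widehat X$ analogously); essential suprema are with respect to $\mu$; $\mathbf 1$ is the constant function $1$; $Z(t):=\int_MU_t\mathbf 1\,d\mu=\int_MU_t^*\mathbf 1\,d\mu\in(0,\infty]$ is the heat content.
   Formalization: Part (a) additionally assumes that μ is finite on all metric balls; with μ only locally finite it fails, e.g. on ℝ² with metric min(|x−x'|,1)+|y−y'|, Lebesgue measure, Brownian motion and V(x,y)=y². *)

theory Defs
  imports "HOL-Probability.Probability"
begin

section \<open>Function spaces\<close>

text \<open>Elements of the \<open>L\<^sup>p\<close> spaces are represented by measurable functions; equality in
  \<open>L\<^sup>p\<close> is equality almost everywhere.\<close>

definition L2 :: "'a measure \<Rightarrow> ('a \<Rightarrow> real) set" where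
  "L2 M = {f \<in> borel_measurable M. integrable M (\<lambda>x. (f x)\<^sup>2)}"

definition L2_norm :: "'a measure \<Rightarrow> ('a \<Rightarrow> real) \<Rightarrow> real" where
  "L2_norm M f = sqrt (\<integral>x. (f x)\<^sup>2 \<partial>M)"

definition Linf :: "'a measure \<Rightarrow> ('a \<Rightarrow> real) set" where
  "Linf M = {f \<in> borel_measurable M. \<exists>C. AE x in M. \<bar>f x\<bar> \<le> C}"

definition Linf_loc :: "'a::topological_space measure \<Rightarrow> ('a \<Rightarrow> real) set" where
  "Linf_loc M = {f \<in> borel_measurable M. \<forall>K. compact K \<longrightarrow> (\<exists>C. AE x in M. x \<in> K \<longrightarrow> \<bar>f x\<bar> \<le> C)}"

definition C_bounded :: "('a::topological_space \<Rightarrow> real) set" where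
  "C_bounded = {f. continuous_on UNIV f \<and> bounded (range f)}"

definition C_infinity :: "('a::topological_space \<Rightarrow> real) set" where
  "C_infinity = {f. continuous_on UNIV f \<and>
     (\<forall>\<epsilon>>0. \<exists>K. compact K \<and> (\<forall>x. x \<notin> K \<longrightarrow> \<bar>f x\<bar> < \<epsilon>))}"

text \<open>The first three clauses say that \<open>T\<close> induces a linear operator on the quotient of \<open>L2 M\<close> by
  almost everywhere equality; the last one is compactness of that operator.\<close>

definition compact_operator_L2 :: "'a measure \<Rightarrow> (('a \<Rightarrow> real) \<Rightarrow> 'a \<Rightarrow> real) \<Rightarrow> bool" where
  "compact_operator_L2 M T \<longleftrightarrow>
     (\<forall>f\<in>L2 M. T f \<in> L2 M) \<and>
     (\<forall>f\<in>L2 M. \<forall>g\<in>L2 M. (AE x in M. f x = g x) \<longrightarrow> (AE x in M. T f x = T g x)) \<and>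
     (\<forall>f\<in>L2 M. \<forall>g\<in>L2 M. \<forall>a b. AE x in M. T (\<lambda>y. a * f y + b * g y) x = a * T f x + b * T g x) \<and>
     (\<forall>F::nat \<Rightarrow> 'a \<Rightarrow> real. (\<forall>n. F n \<in> L2 M) \<and> (\<exists>C. \<forall>n. L2_norm M (F n) \<le> C) \<longrightarrow>
        (\<exists>r g. strict_mono r \<and> g \<in> L2 M \<and>
           (\<lambda>n. L2_norm M (\<lambda>x. T (F (r n)) x - g x)) \<longlonglongrightarrow> 0))"


section \<open>The reference measure\<close>

definition reference_measure :: "'m::topological_space measure \<Rightarrow> bool" where
  "reference_measure \<mu> \<longleftrightarrow>
     sets \<mu> = sets borel \<and>
     (\<forall>x. \<exists>U. open U \<and> x \<in> U \<and> emeasure \<mu> U < \<infinity>) \<and>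
     emeasure \<mu> UNIV = \<infinity> \<and>
     (\<forall>U. open U \<and> U \<noteq> {} \<longrightarrow> emeasure \<mu> U > 0)"


section \<open>Markov processes and their semigroups\<close>

definition natural_filtration ::
  "'w measure \<Rightarrow> (real \<Rightarrow> 'w \<Rightarrow> 'm::topological_space) \<Rightarrow> real \<Rightarrow> 'w set set" where
  "natural_filtration N X s =
     sigma_sets (space N) {X r -` B \<inter> space N | r B. 0 \<le> r \<and> r \<le> s \<and> B \<in> sets borel}"

text \<open>\<open>N\<close> carries the sample space and its sigma-algebra (its measure is irrelevant), and
  \<open>P x\<close> is the law \<open>\<P>\<^sup>x\<close>. The process has infinite lifetime: \<open>X t\<close> takes values in the state space
  for all \<open>t \<ge> 0\<close>, and only these \<open>t\<close> matter. Of the path regularity only joint measurability in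
  time and \<open>\<omega>\<close> is required, which holds in particular for right-continuous paths.\<close>

definition markov_process ::
  "'w measure \<Rightarrow> ('m::topological_space \<Rightarrow> 'w measure) \<Rightarrow> (real \<Rightarrow> 'w \<Rightarrow> 'm) \<Rightarrow> bool" where
  "markov_process N P X \<longleftrightarrow>
     P \<in> borel \<rightarrow>\<^sub>M prob_algebra N \<and>
     (\<lambda>(s, \<omega>). X s \<omega>) \<in> restrict_space borel {0..} \<Otimes>\<^sub>M N \<rightarrow>\<^sub>M borel \<and>
     (\<forall>x. AE \<omega> in P x. X 0 \<omega> = x) \<and>
     (\<forall>x s t \<Lambda> B. 0 \<le> s \<and> 0 \<le> t \<and> \<Lambda> \<in> natural_filtration N X s \<and> B \<in> sets borel \<longrightarrow>
        emeasure (P x) (\<Lambda> \<inter> {\<omega> \<in> space N. X (s + t) \<omega> \<in> B}) =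
        (\<integral>\<^sup>+\<omega>\<in>\<Lambda>. emeasure (P (X s \<omega>)) {\<omega>' \<in> space N. X t \<omega>' \<in> B} \<partial>P x))"

definition transition_semigroup ::
  "('m \<Rightarrow> 'w measure) \<Rightarrow> (real \<Rightarrow> 'w \<Rightarrow> 'm) \<Rightarrow> real \<Rightarrow> ('m \<Rightarrow> real) \<Rightarrow> 'm \<Rightarrow> real" where
  "transition_semigroup P X t f x = (\<integral>\<omega>. f (X t \<omega>) \<partial>P x)"

definition resolvent ::
  "('m \<Rightarrow> 'w measure) \<Rightarrow> (real \<Rightarrow> 'w \<Rightarrow> 'm) \<Rightarrow> real \<Rightarrow> ('m \<Rightarrow> ennreal) \<Rightarrow> 'm \<Rightarrow> ennreal" where
  "resolvent P X \<alpha> f x =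
     (\<integral>\<^sup>+s\<in>{0..}. ennreal (exp (- \<alpha> * s)) * (\<integral>\<^sup>+\<omega>. f (X s \<omega>) \<partial>P x) \<partial>lborel)"

definition L2_contractive :: "'m measure \<Rightarrow> (real \<Rightarrow> ('m \<Rightarrow> real) \<Rightarrow> 'm \<Rightarrow> real) \<Rightarrow> bool" where
  "L2_contractive \<mu> T \<longleftrightarrow>
     (\<forall>t\<ge>0. \<forall>f\<in>L2 \<mu>. T t f \<in> L2 \<mu> \<and> L2_norm \<mu> (T t f) \<le> L2_norm \<mu> f)"

definition feller :: "(real \<Rightarrow> ('m::topological_space \<Rightarrow> real) \<Rightarrow> 'm \<Rightarrow> real) \<Rightarrow> bool" where
  "feller T \<longleftrightarrow>
     (\<forall>t\<ge>0. \<forall>f\<in>C_infinity. T t f \<in> C_infinity) \<and>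
     (\<forall>f\<in>C_infinity. T 0 f = f) \<and>
     (\<forall>s\<ge>0. \<forall>t\<ge>0. \<forall>f\<in>C_infinity. T (s + t) f = T s (T t f)) \<and>
     (\<forall>t\<ge>0. \<forall>f\<in>C_infinity. \<forall>C. (\<forall>x. \<bar>f x\<bar> \<le> C) \<longrightarrow> (\<forall>x. \<bar>T t f x\<bar> \<le> C)) \<and>
     (\<forall>f\<in>C_infinity. uniform_limit UNIV (\<lambda>t. T t f) f (at_right 0))"

definition strong_feller ::
  "'m::topological_space measure \<Rightarrow> (real \<Rightarrow> ('m \<Rightarrow> real) \<Rightarrow> 'm \<Rightarrow> real) \<Rightarrow> bool" where
  "strong_feller \<mu> T \<longleftrightarrow> (\<forall>t>0. \<forall>f\<in>Linf \<mu>. T t f \<in> C_bounded)"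

definition positivity_improving ::
  "'m measure \<Rightarrow> (real \<Rightarrow> ('m \<Rightarrow> real) \<Rightarrow> 'm \<Rightarrow> real) \<Rightarrow> bool" where
  "positivity_improving \<mu> T \<longleftrightarrow>
     (\<forall>t>0. \<forall>f\<in>L2 \<mu>. (AE x in \<mu>. 0 \<le> f x) \<and> \<not> (AE x in \<mu>. f x = 0) \<longrightarrow>
        (AE x in \<mu>. 0 < T t f x))"

definition L2_Linf_bounded :: "'m measure \<Rightarrow> (real \<Rightarrow> ('m \<Rightarrow> real) \<Rightarrow> 'm \<Rightarrow> real) \<Rightarrow> bool" where
  "L2_Linf_bounded \<mu> T \<longleftrightarrow>
     (\<forall>t>0. \<exists>C. \<forall>f\<in>L2 \<mu>. T t f \<in> Linf \<mu> \<and> (AE x in \<mu>. \<bar>T t f x\<bar> \<le> C * L2_norm \<mu> f))"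

definition resolvents_in_weak_duality ::
  "'m::topological_space measure \<Rightarrow> ('m \<Rightarrow> 'w measure) \<Rightarrow> (real \<Rightarrow> 'w \<Rightarrow> 'm) \<Rightarrow>
     ('m \<Rightarrow> 'v measure) \<Rightarrow> (real \<Rightarrow> 'v \<Rightarrow> 'm) \<Rightarrow> bool" where
  "resolvents_in_weak_duality \<mu> P X Ph Xh \<longleftrightarrow>
     (\<forall>\<alpha>>0. \<forall>f\<in>borel_measurable \<mu>. \<forall>g\<in>borel_measurable \<mu>.
        (\<integral>\<^sup>+x. f x * resolvent P X \<alpha> g x \<partial>\<mu>) = (\<integral>\<^sup>+x. resolvent Ph Xh \<alpha> f x * g x \<partial>\<mu>))"

definition semigroups_in_duality ::
  "'m measure \<Rightarrow> (real \<Rightarrow> ('m \<Rightarrow> real) \<Rightarrow> 'm \<Rightarrow> real) \<Rightarrow>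
     (real \<Rightarrow> ('m \<Rightarrow> real) \<Rightarrow> 'm \<Rightarrow> real) \<Rightarrow> bool" where
  "semigroups_in_duality \<mu> T Th \<longleftrightarrow>
     (\<forall>t>0. \<forall>f\<in>L2 \<mu>. \<forall>g\<in>L2 \<mu>. (\<integral>x. f x * T t g x \<partial>\<mu>) = (\<integral>x. Th t f x * g x \<partial>\<mu>))"


section \<open>Exit from the unit ball\<close>

definition exit_time :: "(real \<Rightarrow> 'w \<Rightarrow> 'm) \<Rightarrow> 'm set \<Rightarrow> 'w \<Rightarrow> ereal" where
  "exit_time X B \<omega> = Inf {ereal t | t. 0 < t \<and> X t \<omega> \<notin> B}"

text \<open>The probability \<open>\<P>\<^sup>x(t \<le> \<tau>)\<close> with \<open>\<tau>\<close> the exit time from the open ball \<open>B\<^sub>1(x)\<close>. First exit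
  times are measurable with respect to the completed sigma-algebra, but in general not with respect
  to the original one.\<close>

definition stay_prob ::
  "('m::metric_space \<Rightarrow> 'w measure) \<Rightarrow> (real \<Rightarrow> 'w \<Rightarrow> 'm) \<Rightarrow> real \<Rightarrow> 'm \<Rightarrow> ennreal" where
  "stay_prob P X t x =
     emeasure (completion (P x)) {\<omega> \<in> space (P x). ereal t \<le> exit_time X (ball x 1) \<omega>}"


section \<open>Feynman--Kac semigroups\<close>

text \<open>The weight \<open>exp (- \<integral>\<^sub>0\<^sup>t V(X\<^sub>s) ds)\<close>. As the negative part of \<open>V\<close> is bounded, the time
  integral can only fail to converge by being \<open>+\<infinity>\<close>, and then the weight is \<open>0\<close>.\<close>

definition fk_weight :: "('m \<Rightarrow> real) \<Rightarrow> (real \<Rightarrow> 'w \<Rightarrow> 'm) \<Rightarrow> real \<Rightarrow> 'w \<Rightarrow> real" where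
  "fk_weight V X t \<omega> =
     (if set_integrable lborel {0..t} (\<lambda>s. V (X s \<omega>))
      then exp (- (LINT s:{0..t}|lborel. V (X s \<omega>))) else 0)"

definition feynman_kac ::
  "('m \<Rightarrow> real) \<Rightarrow> ('m \<Rightarrow> 'w measure) \<Rightarrow> (real \<Rightarrow> 'w \<Rightarrow> 'm) \<Rightarrow>
     real \<Rightarrow> ('m \<Rightarrow> real) \<Rightarrow> 'm \<Rightarrow> real" where
  "feynman_kac V P X t f x = (\<integral>\<omega>. fk_weight V X t \<omega> * f (X t \<omega>) \<partial>P x)"

definition heat_content ::
  "'m measure \<Rightarrow> (real \<Rightarrow> ('m \<Rightarrow> real) \<Rightarrow> 'm \<Rightarrow> real) \<Rightarrow> real \<Rightarrow> ennreal" where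
  "heat_content \<mu> U t = (\<integral>\<^sup>+x. ennreal (U t (\<lambda>_. 1) x) \<partial>\<mu>)"

definition exp_ereal :: "ereal \<Rightarrow> ennreal" where
  "exp_ereal z = (if z = \<infinity> then \<infinity> else if z = -\<infinity> then 0 else ennreal (exp (real_of_ereal z)))"

text \<open>The essential supremum of \<open>V\<^sub>+\<close> over \<open>B\<^sub>1(x)\<close>; it may be \<open>\<infinity>\<close> if the ball is not relatively
  compact.\<close>

definition ball_esssup :: "'m::metric_space measure \<Rightarrow> ('m \<Rightarrow> real) \<Rightarrow> 'm \<Rightarrow> ereal" where
  "ball_esssup \<mu> V x = esssup \<mu> (\<lambda>y. ereal (indicator (ball x 1) y * max 0 (V y)))"

end

theory Submission
  imports Defs "HOL-Complex_Analysis.Great_Picard"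
begin

text \<open>
  The upper bound is Jensen's inequality on \<open>[0, t]\<close>: pathwise, \<open>exp (- \<integral> V(X\<^sub>s) ds)\<close> is at most the time
  average of \<open>exp (- t V(X\<^sub>s))\<close>, and Tonelli's theorem turns its expectation into the average of \<open>P\<^sub>s\<close>
  (lemma \<open>nn_integral_fk_weight_le\<close>). For the lower bound one keeps only paths that stay in the unit ball
  up to time \<open>t\<close>; on these \<open>V\<close> is at most its essential supremum at almost every time
  (\<open>exit_lower_bound\<close>). Essential bounds can be evaluated along paths because the law of \<open>X\<^sub>s\<close>,
  \<open>s > 0\<close>, is absolutely continuous from every starting point: boundedness from \<open>L\<^sup>2\<close> to \<open>L\<^sup>\<infinity>\<close> and the
  strong Feller property yield \<open>P\<^sub>t \<bar>f\<bar> \<le> K \<parallel>f\<parallel>\<close> at every point (\<open>ultracontractive_everywhere\<close>), and null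
  sets have indicators of norm \<open>0\<close>.

  The bounds on the heat content follow by integrating over the starting point. The upper one uses
  \<open>\<integral>P\<^sub>s g d\<mu> \<le> \<integral>g d\<mu>\<close> for \<open>g \<ge> 0\<close>, which holds since the dual semigroup maps \<open>1\<close> to at most \<open>1\<close>
  (\<open>subinvariant_if_dual\<close>).

  Compactness rests on two facts. First, for each \<open>x\<close> the functional \<open>f \<mapsto> U\<^sub>t f(x)\<close> is given by a kernel
  \<open>k\<^sub>x\<close> in \<open>L\<^sup>2\<close> (\<open>U_kernel\<close>), and \<open>U\<^sub>t f\<close> is bounded uniformly on the unit ball of \<open>L\<^sup>2\<close>. A bounded
  sequence has a subsequence whose inner products with every element of \<open>L\<^sup>2\<close> converge
  (\<open>L2_bounded_subsequence_weakly_convergent\<close>), so its images converge at every point, and by dominated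
  convergence in \<open>L\<^sup>2(A)\<close> whenever \<open>\<mu> A\<close> is finite. Secondly, by Cauchy--Schwarz \<open>\<bar>U\<^sub>t f\<bar>\<^sup>2\<close> is at most the
  second moment of the Feynman--Kac weight times \<open>P\<^sub>t (f\<^sup>2)\<close>. This second moment is bounded by the average
  of \<open>P\<^sub>s exp (- 2 t V)\<close>, which is small off a set of finite measure because the sublevel sets of \<open>V\<close>, each
  contained in a ball, have finite measure (\<open>weight_small_off_finite_measure\<close>). Hence the tails of the
  images are uniformly small.
\<close>

section \<open>Square-integrable functions\<close>

lemma L2_measurable [measurable_dest]: "f \<in> L2 M \<Longrightarrow> f \<in> borel_measurable M"
  by (simp add: L2_def)

lemma L2_iff_nn_integral:
  "f \<in> L2 M \<longleftrightarrow> f \<in> borel_measurable M \<and> (\<integral>\<^sup>+x. ennreal ((f x)\<^sup>2) \<partial>M) < \<infinity>"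
  unfolding L2_def by (auto simp: integrable_iff_bounded)

lemma L2_norm_nonneg [simp]: "0 \<le> L2_norm M f"
  by (simp add: L2_norm_def)

lemma L2_norm_power2: "(L2_norm M f)\<^sup>2 = (\<integral>x. (f x)\<^sup>2 \<partial>M)"
  by (simp add: L2_norm_def)

lemma nn_integral_square_L2:
  assumes "f \<in> L2 M"
  shows "(\<integral>\<^sup>+x. ennreal ((f x)\<^sup>2) \<partial>M) = ennreal ((L2_norm M f)\<^sup>2)"
  using assms unfolding L2_norm_power2 L2_def by (auto intro: nn_integral_eq_integral)

lemma L2_dominated:
  assumes "g \<in> L2 M" "f \<in> borel_measurable M" "\<And>x. \<bar>f x\<bar> \<le> \<bar>g x\<bar>"
  shows "f \<in> L2 M" "L2_norm M f \<le> L2_norm M g"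
proof -
  have g: "integrable M (\<lambda>x. (g x)\<^sup>2)"
    using assms(1) by (simp add: L2_def)
  have le: "(f x)\<^sup>2 \<le> (g x)\<^sup>2" for x
    using assms(3) by (simp add: abs_le_square_iff)
  have f: "integrable M (\<lambda>x. (f x)\<^sup>2)"
    by (rule Bochner_Integration.integrable_bound[OF g]) (use assms(2) le in auto)
  then show "f \<in> L2 M"
    using assms(2) by (simp add: L2_def)
  show "L2_norm M f \<le> L2_norm M g"
    unfolding L2_norm_def by (intro real_sqrt_le_mono integral_mono f g le)
qed

lemma L2_integrable_mult:
  assumes "f \<in> L2 M" "g \<in> L2 M"
  shows "integrable M (\<lambda>x. f x * g x)"
proof (rule Bochner_Integration.integrable_bound)
  show "integrable M (\<lambda>x. (f x)\<^sup>2 + (g x)\<^sup>2)"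
    using assms by (simp add: L2_def)
  show "(\<lambda>x. f x * g x) \<in> borel_measurable M"
    using assms by (auto simp: L2_def)
  have "\<bar>a * b\<bar> \<le> a\<^sup>2 + b\<^sup>2" for a b :: real
  proof -
    have "\<bar>a * b\<bar> * 2 \<le> a\<^sup>2 + b\<^sup>2"
      using zero_le_power2[of "\<bar>a\<bar> - \<bar>b\<bar>"] by (simp add: power2_eq_square algebra_simps abs_mult)
    then show ?thesis
      using abs_ge_zero[of "a * b"] by linarith
  qed
  then show "AE x in M. norm (f x * g x) \<le> norm ((f x)\<^sup>2 + (g x)\<^sup>2)"
    by auto
qed

lemma L2_lincomb:
  assumes "f \<in> L2 M" "g \<in> L2 M"
  shows "(\<lambda>x. a * f x + b * g x) \<in> L2 M"
proof -
  have "integrable M (\<lambda>x. a\<^sup>2 * (f x)\<^sup>2 + 2 * a * b * (f x * g x) + b\<^sup>2 * (g x)\<^sup>2)"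
    using assms L2_integrable_mult[OF assms] by (auto simp: L2_def)
  also have "(\<lambda>x. a\<^sup>2 * (f x)\<^sup>2 + 2 * a * b * (f x * g x) + b\<^sup>2 * (g x)\<^sup>2)
      = (\<lambda>x. (a * f x + b * g x)\<^sup>2)"
    by (auto simp: fun_eq_iff power2_eq_square algebra_simps)
  finally show ?thesis
    using assms by (auto simp: L2_def)
qed

lemma L2_Cauchy_Schwarz:
  assumes "f \<in> L2 M" "g \<in> L2 M"
  shows "\<bar>\<integral>x. f x * g x \<partial>M\<bar> \<le> L2_norm M f * L2_norm M g"
proof -
  note [measurable] = assms[THEN L2_measurable]
  have "ennreal ((\<integral>x. \<bar>f x * g x\<bar> \<partial>M)\<^sup>2) = (\<integral>\<^sup>+x. ennreal \<bar>f x * g x\<bar> \<partial>M)\<^sup>2"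
    using L2_integrable_mult[OF assms] by (subst nn_integral_eq_integral) (auto simp: ennreal_power)
  also have "\<dots> = (\<integral>\<^sup>+x. ennreal \<bar>f x\<bar> * ennreal \<bar>g x\<bar> \<partial>M)\<^sup>2"
    by (simp add: abs_mult ennreal_mult)
  also have "\<dots> \<le> (\<integral>\<^sup>+x. (ennreal \<bar>f x\<bar>)\<^sup>2 \<partial>M) * (\<integral>\<^sup>+x. (ennreal \<bar>g x\<bar>)\<^sup>2 \<partial>M)"
    by (rule Cauchy_Schwarz_nn_integral) auto
  also have "\<dots> = ennreal ((L2_norm M f * L2_norm M g)\<^sup>2)"
    using assms by (simp add: ennreal_power nn_integral_square_L2 power_mult_distrib ennreal_mult)
  finally have "(\<integral>x. \<bar>f x * g x\<bar> \<partial>M)\<^sup>2 \<le> (L2_norm M f * L2_norm M g)\<^sup>2"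
    by simp
  then have "(\<integral>x. \<bar>f x * g x\<bar> \<partial>M) \<le> L2_norm M f * L2_norm M g"
    by (rule power2_le_imp_le) simp
  then show ?thesis
    using integral_abs_bound[of M "\<lambda>x. f x * g x"] by linarith
qed

text \<open>Sequential weak compactness of balls, expressed through inner products. A diagonal
  argument makes the inner products with every \<open>F m\<close> converge along a subsequence \<open>G\<close>. The functions
  with this property form a subspace \<open>W\<close> that contains all \<open>G m\<close>, and for arbitrary \<open>k\<close> an element
  \<open>s\<close> of \<open>W\<close> that almost minimises the distance to \<open>k\<close> leaves a remainder \<open>k - s\<close> that is almost
  orthogonal to every \<open>G m\<close>, uniformly in \<open>m\<close>.\<close>

lemma L2_bounded_subsequence_weakly_convergent:
  assumes F: "\<And>n. F n \<in> L2 M" and C: "\<And>n. L2_norm M (F n) \<le> C"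
  obtains r :: "nat \<Rightarrow> nat" where "strict_mono r"
    "\<And>k. k \<in> L2 M \<Longrightarrow> convergent (\<lambda>n. \<integral>x. k x * F (r n) x \<partial>M)"
proof -
  have bound: "norm (\<integral>x. F m x * F n x \<partial>M) \<le> C * C" for m n
  proof -
    have "0 \<le> C"
      using C[of 0] L2_norm_nonneg[of M "F 0"] by linarith
    then have "L2_norm M (F m) * L2_norm M (F n) \<le> C * C"
      by (intro mult_mono C) auto
    then show ?thesis
      using L2_Cauchy_Schwarz[OF F F, of m n] by simp
  qed
  obtain r :: "nat \<Rightarrow> nat" where r: "strict_mono r"
    and "\<And>m. m \<in> UNIV \<Longrightarrow> \<exists>l. (\<lambda>n. \<integral>x. F m x * F (r n) x \<partial>M) \<longlonglongrightarrow> l"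
    by (rule function_convergent_subsequence[of "UNIV :: nat set"
          "\<lambda>n m. \<integral>x. F m x * F n x \<partial>M" "C * C"]) (use bound in auto)
  then have lim: "\<exists>l. (\<lambda>n. \<integral>x. F m x * F (r n) x \<partial>M) \<longlonglongrightarrow> l" for m
    by simp
  define G where "G n = F (r n)" for n
  have G: "G n \<in> L2 M" for n
    using F by (simp add: G_def)
  define W where "W = {s \<in> L2 M. convergent (\<lambda>n. \<integral>x. s x * G n x \<partial>M)}"
  have GW: "G m \<in> W" for m
    using lim[of "r m"] G[of m] by (auto simp: W_def G_def convergent_def)
  have W_L2: "s \<in> L2 M" if "s \<in> W" for s
    using that by (simp add: W_def)
  have W_lincomb: "(\<lambda>x. s x + a * G m x) \<in> W" if s: "s \<in> W" for s a m
  proof -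
    have "(\<lambda>x. s x + a * G m x) \<in> L2 M"
      using L2_lincomb[OF W_L2[OF s] G[of m], of 1 a] by simp
    moreover have "(\<integral>x. (s x + a * G m x) * G n x \<partial>M)
        = (\<integral>x. s x * G n x \<partial>M) + a * (\<integral>x. G m x * G n x \<partial>M)" for n
    proof -
      have "(\<integral>x. (s x + a * G m x) * G n x \<partial>M) = (\<integral>x. s x * G n x + a * (G m x * G n x) \<partial>M)"
        by (simp add: algebra_simps)
      also have "\<dots> = (\<integral>x. s x * G n x \<partial>M) + (\<integral>x. a * (G m x * G n x) \<partial>M)"
        using L2_integrable_mult[OF W_L2[OF s] G[of n]] L2_integrable_mult[OF G[of m] G[of n]]
        by (intro Bochner_Integration.integral_add) auto
      finally show ?thesis by simp
    qed
    moreover have "convergent (\<lambda>n. (\<integral>x. s x * G n x \<partial>M) + a * (\<integral>x. G m x * G n x \<partial>M))"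
      using s GW[of m] by (intro convergent_add convergent_mult convergent_const) (auto simp: W_def)
    ultimately show ?thesis
      by (simp add: W_def)
  qed
  define C' where "C' = max C 1"
  have C': "0 < C'" "\<And>m. L2_norm M (G m) \<le> C'"
    using C by (auto simp: C'_def G_def le_max_iff_disj)
  show ?thesis
  proof (rule that[OF r])
    fix k assume k: "k \<in> L2 M"
    define \<delta> where "\<delta> = (INF s\<in>W. (L2_norm M (\<lambda>x. k x - s x))\<^sup>2)"
    have bdd: "bdd_below ((\<lambda>s. (L2_norm M (\<lambda>x. k x - s x))\<^sup>2) ` W)"
      by (rule bdd_belowI2[of _ 0]) simp
    have almost_orthogonal: "\<exists>s\<in>W. \<forall>m. \<bar>\<integral>x. (k x - s x) * G m x \<partial>M\<bar> \<le> e * C'" if e: "0 < e" for e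
    proof -
      have "\<exists>z\<in>(\<lambda>s. (L2_norm M (\<lambda>x. k x - s x))\<^sup>2) ` W. z < \<delta> + e\<^sup>2"
        using e GW by (intro cInf_lessD) (auto simp: \<delta>_def)
      then obtain s where s: "s \<in> W" "(L2_norm M (\<lambda>x. k x - s x))\<^sup>2 < \<delta> + e\<^sup>2"
        by auto
      define u where "u x = k x - s x" for x
      have u: "u \<in> L2 M"
        using L2_lincomb[OF k W_L2[OF s(1)], of 1 "-1"] by (simp add: u_def[abs_def])
      have "\<bar>\<integral>x. u x * G m x \<partial>M\<bar> \<le> e * C'" for m
      proof -
        define c where "c = (\<integral>x. u x * G m x \<partial>M)"
        have quadratic: "2 * a * c \<le> e\<^sup>2 + a\<^sup>2 * C'\<^sup>2" for a
        proof -
          have "\<delta> \<le> (L2_norm M (\<lambda>x. k x - (s x + a * G m x)))\<^sup>2"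
            unfolding \<delta>_def by (rule cINF_lower[OF bdd W_lincomb[OF s(1)]])
          also have "\<dots> = (\<integral>x. (u x)\<^sup>2 - 2 * a * (u x * G m x) + a\<^sup>2 * (G m x)\<^sup>2 \<partial>M)"
            unfolding L2_norm_power2 u_def
            by (intro Bochner_Integration.integral_cong) (auto simp: power2_eq_square algebra_simps)
          also have "\<dots> = (\<integral>x. (u x)\<^sup>2 - 2 * a * (u x * G m x) \<partial>M) + (\<integral>x. a\<^sup>2 * (G m x)\<^sup>2 \<partial>M)"
            using u G[of m] L2_integrable_mult[OF u G[of m]]
            by (intro Bochner_Integration.integral_add Bochner_Integration.integrable_diff) (auto simp: L2_def)
          also have "(\<integral>x. (u x)\<^sup>2 - 2 * a * (u x * G m x) \<partial>M) = (L2_norm M u)\<^sup>2 - 2 * a * c"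
            using u L2_integrable_mult[OF u G[of m]]
            by (subst Bochner_Integration.integral_diff) (auto simp: L2_def c_def L2_norm_power2)
          also have "(\<integral>x. a\<^sup>2 * (G m x)\<^sup>2 \<partial>M) = a\<^sup>2 * (L2_norm M (G m))\<^sup>2"
            by (simp add: L2_norm_power2)
          also have "\<dots> \<le> a\<^sup>2 * C'\<^sup>2"
            by (intro mult_left_mono power_mono C') auto
          finally have "\<delta> \<le> (L2_norm M u)\<^sup>2 - 2 * a * c + a\<^sup>2 * C'\<^sup>2"
            by simp
          moreover have "(L2_norm M u)\<^sup>2 < \<delta> + e\<^sup>2"
            using s(2) by (simp add: u_def[abs_def])
          ultimately show ?thesis by linarith
        qed
        \<comment> \<open>The bound is optimal at \<open>a = \<plusminus> e / C'\<close>.\<close>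
        from quadratic[of "e / C'"] quadratic[of "- e / C'"]
        have "2 * e * \<bar>c\<bar> / C' \<le> 2 * e\<^sup>2"
          using C' by (auto simp: abs_if power_divide)
        then have "\<bar>c\<bar> \<le> e * C'"
          using e C' by (simp add: field_simps power2_eq_square)
        then show ?thesis by (simp add: c_def)
      qed
      then show ?thesis
        using s(1) by (auto simp: u_def)
    qed
    have "Cauchy (\<lambda>n. \<integral>x. k x * G n x \<partial>M)"
    proof (rule metric_CauchyI)
      fix \<epsilon> :: real assume \<epsilon>: "0 < \<epsilon>"
      have e: "0 < \<epsilon> / (4 * C')"
        using \<epsilon> C' by simp
      obtain s where s: "s \<in> W"
        and small: "\<And>m. \<bar>\<integral>x. (k x - s x) * G m x \<partial>M\<bar> \<le> \<epsilon> / (4 * C') * C'"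
        using almost_orthogonal[OF e] by auto
      have small': "\<bar>(\<integral>x. k x * G m x \<partial>M) - (\<integral>x. s x * G m x \<partial>M)\<bar> \<le> \<epsilon> / 4" for m
        using small[of m] C' L2_integrable_mult[OF k G] L2_integrable_mult[OF W_L2[OF s] G]
        by (simp add: left_diff_distrib)
      have "Cauchy (\<lambda>n. \<integral>x. s x * G n x \<partial>M)"
        using s by (auto simp: W_def convergent_eq_Cauchy convergent_def intro: LIMSEQ_imp_Cauchy)
      then obtain n0 where n0: "\<And>m n. m \<ge> n0 \<Longrightarrow> n \<ge> n0 \<Longrightarrow>
          dist (\<integral>x. s x * G m x \<partial>M) (\<integral>x. s x * G n x \<partial>M) < \<epsilon> / 2"
        using metric_CauchyD[OF \<open>Cauchy _\<close>, of "\<epsilon> / 2"] \<epsilon> by auto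
      show "\<exists>n0. \<forall>m\<ge>n0. \<forall>n\<ge>n0. dist (\<integral>x. k x * G m x \<partial>M) (\<integral>x. k x * G n x \<partial>M) < \<epsilon>"
      proof (intro exI[of _ n0] allI impI)
        fix m n assume "m \<ge> n0" "n \<ge> n0"
        then show "dist (\<integral>x. k x * G m x \<partial>M) (\<integral>x. k x * G n x \<partial>M) < \<epsilon>"
          using n0[of m n] small'[of m] small'[of n] unfolding dist_real_def by linarith
      qed
    qed
    then show "convergent (\<lambda>n. \<integral>x. k x * F (r n) x \<partial>M)"
      by (simp add: G_def Cauchy_convergent)
  qed
qed

text \<open>Testing against the truncations \<open>min D n\<close> on sets of finite measure gives
  \<open>\<parallel>f\<parallel>\<^sup>2 \<le> \<integral>D f \<le> K \<parallel>f\<parallel>\<close>, so all truncations have norm at most \<open>K\<close>.\<close>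

lemma (in sigma_finite_measure) L2_if_bounded_functional:
  fixes D :: "'a \<Rightarrow> real"
  assumes D [measurable]: "D \<in> borel_measurable M" and D0: "\<And>x. 0 \<le> D x" and K: "0 \<le> K"
    and bound: "\<And>f. f \<in> L2 M \<Longrightarrow> (\<And>x. 0 \<le> f x) \<Longrightarrow>
      (\<integral>\<^sup>+x. ennreal (D x * f x) \<partial>M) \<le> ennreal (K * L2_norm M f)"
  shows "D \<in> L2 M"
proof -
  obtain A :: "nat \<Rightarrow> 'a set" where A: "range A \<subseteq> sets M" "(\<Union>i. A i) = space M"
    "\<And>i. emeasure M (A i) \<noteq> \<infinity>" "incseq A"
    using sigma_finite_incseq by blast
  have [measurable]: "A n \<in> sets M" for n
    using A(1) by auto
  define f where "f n x = min (D x) (real n) * indicator (A n) x" for n x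
  have f0: "0 \<le> f n x" and fD: "f n x \<le> D x" for n x
    using D0[of x] by (auto simp: f_def indicator_def)
  have [measurable]: "f n \<in> borel_measurable M" for n
    by (simp add: f_def[abs_def])
  have f_L2: "f n \<in> L2 M" for n
  proof -
    have "(\<integral>\<^sup>+x. ennreal ((f n x)\<^sup>2) \<partial>M) \<le> (\<integral>\<^sup>+x. ennreal ((real n)\<^sup>2) * indicator (A n) x \<partial>M)"
      using D0 by (intro nn_integral_mono) (auto simp: f_def indicator_def intro!: power_mono)
    also have "\<dots> < \<infinity>"
      using A(3)[of n] by (simp add: nn_integral_cmult ennreal_mult_less_top less_top)
    finally show ?thesis
      by (simp add: L2_iff_nn_integral)
  qed
  have norm: "(\<integral>\<^sup>+x. ennreal ((f n x)\<^sup>2) \<partial>M) \<le> ennreal (K\<^sup>2)" for n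
  proof -
    have "ennreal ((L2_norm M (f n))\<^sup>2) = (\<integral>\<^sup>+x. ennreal ((f n x)\<^sup>2) \<partial>M)"
      using f_L2 by (simp add: nn_integral_square_L2)
    also have "\<dots> \<le> (\<integral>\<^sup>+x. ennreal (D x * f n x) \<partial>M)"
      using f0 fD by (intro nn_integral_mono ennreal_leI) (auto simp: power2_eq_square intro!: mult_right_mono)
    also have "\<dots> \<le> ennreal (K * L2_norm M (f n))"
      by (intro bound f_L2 f0)
    finally have "L2_norm M (f n) * L2_norm M (f n) \<le> K * L2_norm M (f n)"
      using K by (simp add: power2_eq_square)
    then have "L2_norm M (f n) \<le> K"
      using K L2_norm_nonneg[of M "f n"] by (cases "L2_norm M (f n) = 0") auto
    then show ?thesis
      using f_L2 by (simp add: nn_integral_square_L2 power_mono)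
  qed
  have "(\<integral>\<^sup>+x. ennreal ((D x)\<^sup>2) \<partial>M) \<le> (\<integral>\<^sup>+x. liminf (\<lambda>n. ennreal ((f n x)\<^sup>2)) \<partial>M)"
  proof (intro nn_integral_mono)
    fix x assume "x \<in> space M"
    then obtain i where i: "x \<in> A i"
      using A(2) by auto
    obtain j where j: "D x \<le> real j"
      using real_arch_simple by blast
    have "eventually (\<lambda>n. f n x = D x) sequentially"
      using eventually_ge_at_top[of "max i j"]
    proof eventually_elim
      case (elim n)
      then have "x \<in> A n" "D x \<le> real n"
        using i j incseqD[OF A(4), of i n] by auto
      then show ?case by (simp add: f_def)
    qed
    then have "(\<lambda>n. ennreal ((f n x)\<^sup>2)) \<longlonglongrightarrow> ennreal ((D x)\<^sup>2)"
      by (intro tendsto_eventually) (auto elim: eventually_mono)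
    then show "ennreal ((D x)\<^sup>2) \<le> liminf (\<lambda>n. ennreal ((f n x)\<^sup>2))"
      using lim_imp_Liminf[OF trivial_limit_sequentially] by (metis order_refl)
  qed
  also have "\<dots> \<le> liminf (\<lambda>n. \<integral>\<^sup>+x. ennreal ((f n x)\<^sup>2) \<partial>M)"
    by (rule nn_integral_liminf) simp
  also have "\<dots> \<le> ennreal (K\<^sup>2)"
    using norm by (intro Liminf_le) auto
  also have "\<dots> < \<infinity>" by simp
  finally show ?thesis
    by (simp add: L2_iff_nn_integral)
qed

text \<open>A Vitali-type convergence theorem: off a set of finite measure the tails are uniformly small,
  on that set dominated convergence applies.\<close>

lemma L2_convergence_uniform_tails:
  fixes h :: "nat \<Rightarrow> 'a \<Rightarrow> real"
  assumes h: "\<And>n. h n \<in> L2 M" and bound: "\<And>n x. \<bar>h n x\<bar> \<le> B"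
    and lim: "\<And>x. (\<lambda>n. h n x) \<longlonglongrightarrow> g x"
    and tails: "\<And>\<epsilon>. 0 < \<epsilon> \<Longrightarrow> \<exists>A\<in>sets M. emeasure M A < \<infinity> \<and>
      (\<forall>n. (\<integral>\<^sup>+x\<in>-A. ennreal ((h n x)\<^sup>2) \<partial>M) \<le> ennreal \<epsilon>)"
  shows "g \<in> L2 M" "(\<lambda>n. L2_norm M (\<lambda>x. h n x - g x)) \<longlonglongrightarrow> 0"
proof -
  have [measurable]: "h n \<in> borel_measurable M" for n
    using h by (simp add: L2_def)
  have g_meas [measurable]: "g \<in> borel_measurable M"
    by (rule borel_measurable_LIMSEQ_real[OF lim]) simp
  have g_bound: "\<bar>g x\<bar> \<le> B" for x
    using bound by (intro LIMSEQ_le_const2[OF tendsto_rabs[OF lim]]) auto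
  have B: "0 \<le> B"
    using g_bound abs_ge_zero order_trans by blast
  define I where "I n = (\<integral>\<^sup>+x. ennreal ((h n x - g x)\<^sup>2) \<partial>M)" for n
  have I_small: "eventually (\<lambda>n. I n < ennreal (5 * \<epsilon>)) sequentially" if \<epsilon>: "0 < \<epsilon>" for \<epsilon>
  proof -
    obtain A where [measurable]: "A \<in> sets M" and A: "emeasure M A < \<infinity>"
      and tail: "\<And>n. (\<integral>\<^sup>+x\<in>-A. ennreal ((h n x)\<^sup>2) \<partial>M) \<le> ennreal \<epsilon>"
      using tails[OF \<epsilon>] by auto
    have "(indicator (- A) :: _ \<Rightarrow> ennreal) = (\<lambda>x. if x \<in> A then 0 else 1)"
      by (auto simp: indicator_def)
    then have [measurable]: "(indicator (- A) :: _ \<Rightarrow> ennreal) \<in> borel_measurable M"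
      by simp
    have "(\<integral>\<^sup>+x\<in>-A. ennreal ((g x)\<^sup>2) \<partial>M)
        = (\<integral>\<^sup>+x. liminf (\<lambda>n. ennreal ((h n x)\<^sup>2) * indicator (-A) x) \<partial>M)"
    proof (intro nn_integral_cong)
      fix x
      have "(\<lambda>n. ennreal ((h n x)\<^sup>2) * indicator (-A) x) \<longlonglongrightarrow> ennreal ((g x)\<^sup>2) * indicator (-A) x"
        using lim[of x] by (cases "x \<in> A") (auto intro!: tendsto_intros)
      then show "ennreal ((g x)\<^sup>2) * indicator (-A) x
          = liminf (\<lambda>n. ennreal ((h n x)\<^sup>2) * indicator (-A) x)"
        by (simp add: lim_imp_Liminf)
    qed
    also have "\<dots> \<le> liminf (\<lambda>n. \<integral>\<^sup>+x\<in>-A. ennreal ((h n x)\<^sup>2) \<partial>M)"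
      by (rule nn_integral_liminf) simp
    also have "\<dots> \<le> ennreal \<epsilon>"
      using tail by (intro Liminf_le) auto
    finally have g_tail: "(\<integral>\<^sup>+x\<in>-A. ennreal ((g x)\<^sup>2) \<partial>M) \<le> ennreal \<epsilon>" .
    have "(\<lambda>n. \<integral>\<^sup>+x. ennreal ((h n x - g x)\<^sup>2) * indicator A x \<partial>M) \<longlonglongrightarrow> (\<integral>\<^sup>+x. (0::ennreal) \<partial>M)"
    proof (rule nn_integral_dominated_convergence[where w="\<lambda>x. ennreal ((2 * B)\<^sup>2) * indicator A x"])
      show "(\<integral>\<^sup>+x. ennreal ((2 * B)\<^sup>2) * indicator A x \<partial>M) < \<infinity>"
        using A by (simp add: nn_integral_cmult ennreal_mult_less_top)
      have "(h n x - g x)\<^sup>2 \<le> (2 * B)\<^sup>2" for n x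
        using bound[of n x] g_bound[of x] B by (subst abs_le_square_iff[symmetric]) auto
      then show "AE x in M. ennreal ((h n x - g x)\<^sup>2) * indicator A x
          \<le> ennreal ((2 * B)\<^sup>2) * indicator A x" for n
        by (intro AE_I2 mult_right_mono ennreal_leI) auto
      show "AE x in M. (\<lambda>n. ennreal ((h n x - g x)\<^sup>2) * indicator A x) \<longlonglongrightarrow> 0"
      proof (rule AE_I2)
        fix x
        have "(\<lambda>n. ennreal ((h n x - g x)\<^sup>2)) \<longlonglongrightarrow> ennreal ((g x - g x)\<^sup>2)"
          by (intro tendsto_intros lim)
        then show "(\<lambda>n. ennreal ((h n x - g x)\<^sup>2) * indicator A x) \<longlonglongrightarrow> 0"
          by (cases "x \<in> A") auto
      qed
    qed simp_all
    then have "eventually (\<lambda>n. (\<integral>\<^sup>+x. ennreal ((h n x - g x)\<^sup>2) * indicator A x \<partial>M) < ennreal \<epsilon>) sequentially"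
      using \<epsilon> by (intro order_tendstoD(2)) auto
    then show ?thesis
    proof eventually_elim
      case (elim n)
      have "(h n x - g x)\<^sup>2 \<le> 2 * (h n x)\<^sup>2 + 2 * (g x)\<^sup>2" for x
        using zero_le_power2[of "h n x + g x"] by (simp add: power2_eq_square algebra_simps)
      moreover have twice: "2 * ennreal a = ennreal (2 * a)" for a
        by (simp add: ennreal_mult')
      ultimately have le: "ennreal ((h n x - g x)\<^sup>2) \<le> 2 * ennreal ((h n x)\<^sup>2) + 2 * ennreal ((g x)\<^sup>2)" for x
        unfolding twice by (subst ennreal_plus[symmetric]) (auto intro!: ennreal_leI simp del: ennreal_plus)
      have "I n \<le> (\<integral>\<^sup>+x. ennreal ((h n x - g x)\<^sup>2) * indicator A x
          + (2 * (ennreal ((h n x)\<^sup>2) * indicator (-A) x) + 2 * (ennreal ((g x)\<^sup>2) * indicator (-A) x)) \<partial>M)"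
        unfolding I_def using le by (intro nn_integral_mono) (auto simp: indicator_def)
      also have "\<dots> = (\<integral>\<^sup>+x. ennreal ((h n x - g x)\<^sup>2) * indicator A x \<partial>M)
          + (2 * (\<integral>\<^sup>+x\<in>-A. ennreal ((h n x)\<^sup>2) \<partial>M) + 2 * (\<integral>\<^sup>+x\<in>-A. ennreal ((g x)\<^sup>2) \<partial>M))"
        by (simp add: nn_integral_add nn_integral_cmult)
      also have "\<dots> \<le> (\<integral>\<^sup>+x. ennreal ((h n x - g x)\<^sup>2) * indicator A x \<partial>M) + (2 * ennreal \<epsilon> + 2 * ennreal \<epsilon>)"
        by (intro add_mono mult_left_mono tail g_tail order_refl) auto
      also have "2 * ennreal \<epsilon> + 2 * ennreal \<epsilon> = ennreal (4 * \<epsilon>)"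
        unfolding twice using \<epsilon> by (subst ennreal_plus[symmetric]) auto
      also have "(\<integral>\<^sup>+x. ennreal ((h n x - g x)\<^sup>2) * indicator A x \<partial>M) + ennreal (4 * \<epsilon>)
          < ennreal \<epsilon> + ennreal (4 * \<epsilon>)"
        using elim by (simp add: add.commute[of _ "ennreal (4 * \<epsilon>)"] ennreal_add_left_cancel_less)
      also have "\<dots> = ennreal (5 * \<epsilon>)"
        using \<epsilon> by (subst ennreal_plus[symmetric]) auto
      finally show ?case .
    qed
  qed
  have diff_L2: "(\<lambda>x. h n x - g x) \<in> L2 M" if "I n < \<infinity>" for n
    using that by (simp add: L2_iff_nn_integral I_def)
  obtain n where "I n < ennreal (5 * 1)"
    using eventually_happens[OF I_small[of 1]] by auto
  then have "I n < \<infinity>"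
    by (rule less_trans) simp
  from L2_lincomb[OF h[of n] diff_L2[OF this], of 1 "-1"] show "g \<in> L2 M"
    by simp
  show "(\<lambda>n. L2_norm M (\<lambda>x. h n x - g x)) \<longlonglongrightarrow> 0"
  proof (rule tendstoI)
    fix e :: real assume e: "0 < e"
    then have "0 < e\<^sup>2 / 5" by simp
    from I_small[OF this] show "eventually (\<lambda>n. dist (L2_norm M (\<lambda>x. h n x - g x)) 0 < e) sequentially"
    proof eventually_elim
      case (elim n)
      then have "I n < \<infinity>"
        by (rule less_trans) simp
      from nn_integral_square_L2[OF diff_L2[OF this]] elim
      have "(L2_norm M (\<lambda>x. h n x - g x))\<^sup>2 < e\<^sup>2"
        by (simp add: I_def ennreal_less_iff)
      then have "L2_norm M (\<lambda>x. h n x - g x) < e"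
        by (rule power2_less_imp_less) (use e in simp)
      then show ?case by simp
    qed
  qed
qed

section \<open>Averaging the potential along a path\<close>

text \<open>Jensen's inequality for the uniform distribution on \<open>[0, t]\<close> and \<open>exp\<close>, obtained by integrating
  the tangent line of \<open>exp\<close> at the mean value.\<close>

lemma exp_neg_integral_le_average:
  fixes v :: "real \<Rightarrow> real"
  assumes t: "0 < t" and v: "set_integrable lborel {0..t} v"
  shows "ennreal (exp (- (LINT s:{0..t}|lborel. v s)))
    \<le> ennreal (1 / t) * (\<integral>\<^sup>+s\<in>{0..t}. ennreal (exp (- t * v s)) \<partial>lborel)"
proof -
  define u where "u s = indicator {0..t} s * v s" for s
  define a where "a = (LINT s:{0..t}|lborel. v s)"
  have u: "integrable lborel u" "(\<integral>s. u s \<partial>lborel) = a"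
    using v by (simp_all add: u_def[abs_def] a_def set_integrable_def set_lebesgue_integral_def)
  note [measurable] = borel_measurable_integrable[OF u(1)]
  define e where "e s = indicator {0..t} s * exp (- t * u s)" for s
  have [measurable]: "e \<in> borel_measurable lborel"
    by (simp add: e_def[abs_def])
  have e: "(\<integral>\<^sup>+s\<in>{0..t}. ennreal (exp (- t * v s)) \<partial>lborel) = (\<integral>\<^sup>+s. ennreal (e s) \<partial>lborel)"
    by (intro nn_integral_cong) (auto simp: e_def u_def indicator_def)
  have le: "ennreal (t * exp (- a)) \<le> (\<integral>\<^sup>+s. ennreal (e s) \<partial>lborel)"
  proof (cases "(\<integral>\<^sup>+s. ennreal (e s) \<partial>lborel) = \<infinity>")
    case False
    have e0: "0 \<le> e s" for s
      by (simp add: e_def)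
    have int_e: "integrable lborel e"
      using False e0 by (intro integrableI_nonneg) (auto simp: less_top)
    have int_l: "integrable lborel (\<lambda>s. exp (- a) * ((1 + a) * indicator {0..t} s - t * u s))"
      using u t by (intro integrable_mult_right Bochner_Integration.integrable_diff) auto
    have "t * exp (- a) = exp (- a) * ((1 + a) * t - t * a)"
      by (simp add: algebra_simps)
    also have "\<dots> = (\<integral>s. exp (- a) * ((1 + a) * indicator {0..t} s - t * u s) \<partial>lborel)"
      using u t by simp
    also have "\<dots> \<le> (\<integral>s. e s \<partial>lborel)"
    proof (rule integral_mono[OF int_l int_e])
      fix s
      have "exp (- a) * (1 + (a - t * v s)) \<le> exp (- a) * exp (a - t * v s)"
        by (intro mult_left_mono exp_ge_add_one_self) simp
      also have "\<dots> = exp (- t * v s)"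
        by (simp add: exp_add[symmetric])
      finally show "exp (- a) * ((1 + a) * indicator {0..t} s - t * u s) \<le> e s"
        by (auto simp: e_def u_def indicator_def algebra_simps)
    qed
    finally have "t * exp (- a) \<le> (\<integral>s. e s \<partial>lborel)" .
    then show ?thesis
      using int_e e0 by (subst nn_integral_eq_integral) (auto intro: ennreal_leI)
  qed simp
  have "ennreal (exp (- a)) = ennreal (1 / t) * ennreal (t * exp (- a))"
    using t by (subst ennreal_mult[symmetric]) auto
  also have "\<dots> \<le> ennreal (1 / t) * (\<integral>\<^sup>+s. ennreal (e s) \<partial>lborel)"
    by (intro mult_left_mono le) simp
  finally show ?thesis
    unfolding e a_def .
qed

lemma fk_weight_nonneg [simp]: "0 \<le> fk_weight V X t \<omega>"
  by (simp add: fk_weight_def)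

lemma fk_weight_le_average:
  assumes "0 < t"
  shows "ennreal (fk_weight V X t \<omega>)
    \<le> ennreal (1 / t) * (\<integral>\<^sup>+s\<in>{0..t}. ennreal (exp (- t * V (X s \<omega>))) \<partial>lborel)"
  using exp_neg_integral_le_average[OF assms, of "\<lambda>s. V (X s \<omega>)"] by (simp add: fk_weight_def)

text \<open>Second moments of the weight are thereby first moments for the doubled potential.\<close>

lemma fk_weight_power2: "(fk_weight V X t \<omega>)\<^sup>2 = fk_weight (\<lambda>x. 2 * V x) X t \<omega>"
proof -
  have "set_integrable lborel {0..t} (\<lambda>s. 2 * V (X s \<omega>)) \<longleftrightarrow>
      set_integrable lborel {0..t} (\<lambda>s. V (X s \<omega>))"
    by (subst set_integrable_mult_right_iff) auto
  then show ?thesis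
    by (simp add: fk_weight_def power2_eq_square exp_add[symmetric])
qed

section \<open>Measurability of the process and of its Feynman--Kac weight\<close>

locale measurable_process =
  fixes N :: "'w measure" and P :: "'m::polish_space \<Rightarrow> 'w measure" and X :: "real \<Rightarrow> 'w \<Rightarrow> 'm"
  assumes kernel: "P \<in> borel \<rightarrow>\<^sub>M prob_algebra N"
    and joint: "(\<lambda>(s, \<omega>). X s \<omega>) \<in> restrict_space borel {0..} \<Otimes>\<^sub>M N \<rightarrow>\<^sub>M borel"
begin

lemma P_in_space: "P x \<in> space (prob_algebra N)"
  using measurable_space[OF kernel] by simp

lemma sets_P [measurable_cong]: "sets (P x) = sets N"
  using P_in_space[of x] by (simp add: space_prob_algebra)

lemma prob_space_P: "prob_space (P x)"
  using P_in_space[of x] by (simp add: space_prob_algebra)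

lemma kernel_subprob: "P \<in> borel \<rightarrow>\<^sub>M subprob_algebra N"
  using kernel by (rule measurable_prob_algebraD)

text \<open>Clipping the time at \<open>0\<close> gives a version that is measurable on all of \<open>\<real>\<close>.\<close>

lemma measurable_clipped [measurable]: "(\<lambda>(s, \<omega>). X (max 0 s) \<omega>) \<in> borel \<Otimes>\<^sub>M N \<rightarrow>\<^sub>M borel"
proof -
  have "(\<lambda>s::real. max 0 s) \<in> borel \<rightarrow>\<^sub>M restrict_space borel {0..}"
    by (intro measurable_restrict_space2) auto
  then have "(\<lambda>p. (max 0 (fst p), snd p)) \<in> borel \<Otimes>\<^sub>M N \<rightarrow>\<^sub>M restrict_space (borel :: real measure) {0..} \<Otimes>\<^sub>M N"
    by (intro measurable_Pair measurable_compose[OF measurable_fst]) auto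
  from measurable_compose[OF this joint] show ?thesis
    by (simp add: case_prod_beta')
qed

lemma measurable_X [measurable]: "0 \<le> s \<Longrightarrow> X s \<in> N \<rightarrow>\<^sub>M borel"
  using measurable_compose[OF measurable_Pair1'[of s borel N] measurable_clipped]
  by (simp add: max_def)

lemma measurable_fk_weight [measurable]:
  assumes [measurable]: "V \<in> borel_measurable borel"
  shows "fk_weight V X t \<in> borel_measurable N"
proof -
  have eq: "indicator {0..t} s *\<^sub>R V (X s \<omega>) = indicator {0..t} s *\<^sub>R V (X (max 0 s) \<omega>)" for s \<omega>
    by (auto simp: indicator_def max_def)
  have [measurable]: "(\<lambda>(\<omega>, s). indicator {0..t} s *\<^sub>R V (X (max 0 s) \<omega>)) \<in> borel_measurable (N \<Otimes>\<^sub>M lborel)"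
    by measurable
  show ?thesis
    unfolding fk_weight_def set_integrable_def set_lebesgue_integral_def eq by measurable
qed

lemma measurable_expectation [measurable]:
  assumes [measurable]: "g \<in> borel_measurable borel"
  shows "(\<lambda>(x, s). \<integral>\<^sup>+\<omega>. g (X (max 0 s) \<omega>) \<partial>P x) \<in> borel_measurable (borel \<Otimes>\<^sub>M borel)"
proof -
  have "(\<lambda>p. \<integral>\<^sup>+\<omega>. g (X (max 0 (snd p)) \<omega>) \<partial>P (fst p)) \<in> borel_measurable (borel \<Otimes>\<^sub>M borel)"
    by (rule nn_integral_measurable_subprob_algebra2[where N = N])
      (auto intro!: measurable_compose[OF measurable_fst kernel_subprob])
  then show ?thesis
    by (simp add: case_prod_beta')
qed

lemma measurable_time_average:
  assumes [measurable]: "g \<in> borel_measurable borel"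
  shows "(\<lambda>x. \<integral>\<^sup>+s\<in>{0..t}. (\<integral>\<^sup>+\<omega>. g (X s \<omega>) \<partial>P x) \<partial>lborel) \<in> borel_measurable borel"
proof -
  have "(\<lambda>x. \<integral>\<^sup>+s. (\<lambda>(x, s). \<integral>\<^sup>+\<omega>. g (X (max 0 s) \<omega>) \<partial>P x) (x, s) * indicator {0..t} s \<partial>lborel)
      \<in> borel_measurable borel"
    by measurable
  also have "(\<lambda>x. \<integral>\<^sup>+s. (\<lambda>(x, s). \<integral>\<^sup>+\<omega>. g (X (max 0 s) \<omega>) \<partial>P x) (x, s) * indicator {0..t} s \<partial>lborel)
      = (\<lambda>x. \<integral>\<^sup>+s\<in>{0..t}. (\<integral>\<^sup>+\<omega>. g (X s \<omega>) \<partial>P x) \<partial>lborel)"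
    by (intro ext nn_integral_cong) (auto simp: indicator_def max_def)
  finally show ?thesis .
qed

text \<open>The pathwise Jensen bound in expectation. It serves for \<open>V\<close> in the
  bounds on \<open>U t 1\<close> and for \<open>2 V\<close> in the estimate of the second moment of the weight.\<close>

lemma nn_integral_fk_weight_le:
  assumes t: "0 < t" and [measurable]: "V \<in> borel_measurable borel"
  shows "(\<integral>\<^sup>+\<omega>. ennreal (fk_weight V X t \<omega>) \<partial>P x)
    \<le> ennreal (1 / t) * (\<integral>\<^sup>+s\<in>{0..t}. (\<integral>\<^sup>+\<omega>. ennreal (exp (- t * V (X s \<omega>))) \<partial>P x) \<partial>lborel)"
proof -
  interpret prob_space "P x" by (rule prob_space_P)
  interpret pair_sigma_finite lborel "P x" ..
  define g where "g s \<omega> = ennreal (exp (- t * V (X (max 0 s) \<omega>))) * indicator {0..t} s" for s \<omega>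
  have g: "ennreal (exp (- t * V (X s \<omega>))) * indicator {0..t} s = g s \<omega>" for s \<omega>
    by (auto simp: g_def indicator_def max_def)
  have [measurable]: "(\<lambda>(s, \<omega>). g s \<omega>) \<in> borel_measurable (lborel \<Otimes>\<^sub>M P x)"
    unfolding g_def by measurable
  have "(\<integral>\<^sup>+\<omega>. ennreal (fk_weight V X t \<omega>) \<partial>P x)
      \<le> (\<integral>\<^sup>+\<omega>. ennreal (1 / t) * (\<integral>\<^sup>+s. g s \<omega> \<partial>lborel) \<partial>P x)"
    using fk_weight_le_average[OF t, of V X] unfolding g by (intro nn_integral_mono)
  also have "\<dots> = ennreal (1 / t) * (\<integral>\<^sup>+\<omega>. (\<integral>\<^sup>+s. g s \<omega> \<partial>lborel) \<partial>P x)"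
    by (rule nn_integral_cmult) measurable
  also have "(\<integral>\<^sup>+\<omega>. (\<integral>\<^sup>+s. g s \<omega> \<partial>lborel) \<partial>P x) = (\<integral>\<^sup>+s. (\<integral>\<^sup>+\<omega>. g s \<omega> \<partial>P x) \<partial>lborel)"
    by (rule Fubini') measurable
  also have "\<dots> = (\<integral>\<^sup>+s\<in>{0..t}. (\<integral>\<^sup>+\<omega>. ennreal (exp (- t * V (X s \<omega>))) \<partial>P x) \<partial>lborel)"
    by (intro nn_integral_cong) (auto simp: g_def indicator_def max_def)
  finally show ?thesis .
qed

lemma borel_measurable_feynman_kac:
  assumes [measurable]: "V \<in> borel_measurable borel" "f \<in> borel_measurable borel" and "0 \<le> t"
  shows "feynman_kac V P X t f \<in> borel_measurable borel"
proof -
  have [measurable]: "X t \<in> N \<rightarrow>\<^sub>M borel"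
    using assms by measurable
  show ?thesis
    unfolding feynman_kac_def[abs_def]
    by (rule measurable_compose[OF kernel_subprob integral_measurable_subprob_algebra]) measurable
qed

end

section \<open>Absolutely continuous laws and potentials bounded below\<close>

text \<open>What the analysis uses of the semigroup \<open>P\<^sub>t\<close>: it maps \<open>L\<^sup>2\<close> boundedly into bounded functions,
  with the bound valid at every starting point and not merely almost everywhere, and \<open>\<mu>\<close> is an excessive
  measure for it.\<close>

locale ultracontractive_process = measurable_process N P X
  for N :: "'w measure" and P :: "'m::polish_space \<Rightarrow> 'w measure" and X :: "real \<Rightarrow> 'w \<Rightarrow> 'm" +
  fixes \<mu> :: "'m measure"
  assumes sets_\<mu> [measurable_cong]: "sets \<mu> = sets borel"
    and sigma_finite_\<mu>: "sigma_finite_measure \<mu>"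
    and ultracontractive: "\<And>t. 0 < t \<Longrightarrow>
      \<exists>K. \<forall>x. \<forall>f\<in>L2 \<mu>. (\<integral>\<^sup>+\<omega>. ennreal \<bar>f (X t \<omega>)\<bar> \<partial>P x) \<le> ennreal (K * L2_norm \<mu> f)"
    and subinvariant: "\<And>s g. 0 < s \<Longrightarrow> g \<in> borel_measurable borel \<Longrightarrow>
      (\<integral>\<^sup>+x. (\<integral>\<^sup>+\<omega>. g (X s \<omega>) \<partial>P x) \<partial>\<mu>) \<le> (\<integral>\<^sup>+x. g x \<partial>\<mu>)"
begin

sublocale sigma_finite_measure \<mu>
  by (rule sigma_finite_\<mu>)

lemma borel_measurable_\<mu> [simp]: "borel_measurable \<mu> = borel_measurable borel"
  by (rule measurable_cong_sets) (auto simp: sets_\<mu>)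

text \<open>The indicator of a null set has norm \<open>0\<close> in \<open>L\<^sup>2\<close>, so by ultracontractivity the law of \<open>X s\<close>
  does not charge it, from any starting point.\<close>

lemma AE_law:
  assumes s: "0 < s" and Q: "AE y in \<mu>. Q y"
  shows "AE \<omega> in P x. Q (X s \<omega>)"
proof -
  obtain A where A: "{y \<in> space \<mu>. \<not> Q y} \<subseteq> A" "A \<in> null_sets \<mu>"
    using Q by (auto elim: AE_E3 simp: null_sets_def intro: AE_E)
  have [measurable]: "A \<in> sets borel"
    using A(2) by (auto simp: null_sets_def sets_\<mu>)
  have [measurable]: "X s \<in> N \<rightarrow>\<^sub>M borel"
    using s by (intro measurable_X) simp
  have "(\<integral>\<^sup>+y. ennreal ((indicator A y)\<^sup>2) \<partial>\<mu>) = (\<integral>\<^sup>+y. indicator A y \<partial>\<mu>)"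
    by (intro nn_integral_cong) (auto simp: indicator_def)
  also have "\<dots> = 0"
    using A(2) by (simp add: sets_\<mu> null_sets_def)
  finally have zero: "(\<integral>\<^sup>+y. ennreal ((indicator A y)\<^sup>2) \<partial>\<mu>) = 0" .
  then have ind: "indicator A \<in> L2 \<mu>"
    by (simp add: L2_iff_nn_integral)
  from nn_integral_square_L2[OF this] zero have "L2_norm \<mu> (indicator A) = 0"
    by simp
  then have "(\<integral>\<^sup>+\<omega>. ennreal \<bar>indicator A (X s \<omega>)\<bar> \<partial>P x) \<le> 0"
    using ultracontractive[OF s] ind by (metis ennreal_0 mult_zero_right)
  then have "AE \<omega> in P x. ennreal \<bar>indicator A (X s \<omega>)\<bar> = 0"
    by (subst (asm) le_zero_eq, subst (asm) nn_integral_0_iff_AE) auto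
  then show ?thesis
  proof eventually_elim
    case (elim \<omega>)
    then have "X s \<omega> \<notin> A"
      by (auto simp: indicator_def split: if_splits)
    then show ?case
      using A(1) by (auto simp: sets_eq_imp_space_eq[OF sets_\<mu>])
  qed
qed

text \<open>Tonelli's theorem transfers the preceding property to almost all times along almost every path. The
  time \<open>0\<close>, where the law may be a point mass, is a Lebesgue null set.\<close>

lemma AE_path:
  assumes Q: "AE y in \<mu>. Q y"
  shows "AE \<omega> in P x. AE s in lborel. 0 \<le> s \<longrightarrow> Q (X s \<omega>)"
proof -
  interpret prob_space "P x" by (rule prob_space_P)
  interpret pair_sigma_finite lborel "P x" ..
  obtain A where A: "{y \<in> space \<mu>. \<not> Q y} \<subseteq> A" "A \<in> null_sets \<mu>"
    using Q by (auto elim: AE_E3 simp: null_sets_def intro: AE_E)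
  have [measurable]: "A \<in> sets borel"
    using A(2) by (auto simp: null_sets_def sets_\<mu>)
  have "AE y in \<mu>. y \<notin> A"
    using A(2) by (rule AE_not_in)
  note law = AE_law[OF _ this]
  define g :: "real \<Rightarrow> 'w \<Rightarrow> ennreal" where "g s \<omega> = indicator A (X (max 0 s) \<omega>) * indicator {0<..} s" for s \<omega>
  have [measurable]: "(\<lambda>(s, \<omega>). g s \<omega>) \<in> borel_measurable (lborel \<Otimes>\<^sub>M P x)"
    unfolding g_def by measurable
  have "(\<integral>\<^sup>+\<omega>. (\<integral>\<^sup>+s. g s \<omega> \<partial>lborel) \<partial>P x) = (\<integral>\<^sup>+s. (\<integral>\<^sup>+\<omega>. g s \<omega> \<partial>P x) \<partial>lborel)"
    by (rule Fubini') measurable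
  also have "\<dots> = (\<integral>\<^sup>+s. (0::ennreal) \<partial>(lborel :: real measure))"
  proof (intro nn_integral_cong)
    fix s :: real
    have "AE \<omega> in P x. g s \<omega> = 0"
    proof (cases "0 < s")
      case True
      from law[OF True] show ?thesis
        by eventually_elim (use True in \<open>simp add: g_def max_def\<close>)
    qed (simp add: g_def)
    then have "(\<integral>\<^sup>+\<omega>. g s \<omega> \<partial>P x) = (\<integral>\<^sup>+\<omega>. 0 \<partial>P x)"
      by (rule nn_integral_cong_AE)
    then show "(\<integral>\<^sup>+\<omega>. g s \<omega> \<partial>P x) = 0"
      by simp
  qed
  also have "\<dots> = 0"
    by simp
  finally have "AE \<omega> in P x. (\<integral>\<^sup>+s. g s \<omega> \<partial>lborel) = 0"
    by (subst (asm) nn_integral_0_iff_AE) auto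
  then show ?thesis
    using AE_space
  proof eventually_elim
    case (elim \<omega>)
    then have "\<omega> \<in> space N"
      using sets_eq_imp_space_eq[OF sets_P] by auto
    then have [measurable]: "(\<lambda>s. g s \<omega>) \<in> borel_measurable lborel"
      unfolding g_def by measurable
    have "AE s in lborel. g s \<omega> = 0"
      using elim(1) by (subst (asm) nn_integral_0_iff_AE) auto
    then show ?case
      using AE_lborel_singleton[of 0]
    proof eventually_elim
      case (elim s)
      then show ?case
        using A(1) by (auto simp: g_def indicator_def max_def sets_eq_imp_space_eq[OF sets_\<mu>] split: if_splits)
    qed
  qed
qed

lemma averaged_subinvariance:
  assumes t: "0 < t" and [measurable]: "g \<in> borel_measurable borel"
  shows "(\<integral>\<^sup>+x. (\<integral>\<^sup>+s\<in>{0..t}. (\<integral>\<^sup>+\<omega>. g (X s \<omega>) \<partial>P x) \<partial>lborel) \<partial>\<mu>) \<le> ennreal t * (\<integral>\<^sup>+x. g x \<partial>\<mu>)"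
proof -
  interpret pair_sigma_finite lborel \<mu> ..
  define q where "q s x = (\<integral>\<^sup>+\<omega>. g (X (max 0 s) \<omega>) \<partial>P x) * indicator {0..t} s" for s x
  have "(\<lambda>(s, x). (\<lambda>(x, s). \<integral>\<^sup>+\<omega>. g (X (max 0 s) \<omega>) \<partial>P x) (x, s) * indicator {0..t} s)
      \<in> borel_measurable (lborel \<Otimes>\<^sub>M \<mu>)"
    by measurable
  then have [measurable]: "(\<lambda>(s, x). q s x) \<in> borel_measurable (lborel \<Otimes>\<^sub>M \<mu>)"
    by (simp add: q_def)
  have "(\<integral>\<^sup>+x. (\<integral>\<^sup>+s\<in>{0..t}. (\<integral>\<^sup>+\<omega>. g (X s \<omega>) \<partial>P x) \<partial>lborel) \<partial>\<mu>) = (\<integral>\<^sup>+x. (\<integral>\<^sup>+s. q s x \<partial>lborel) \<partial>\<mu>)"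
    by (intro nn_integral_cong) (auto simp: q_def indicator_def max_def)
  also have "\<dots> = (\<integral>\<^sup>+s. (\<integral>\<^sup>+x. q s x \<partial>\<mu>) \<partial>lborel)"
    by (rule Fubini') measurable
  also have "\<dots> \<le> (\<integral>\<^sup>+s\<in>{0..t}. (\<integral>\<^sup>+x. g x \<partial>\<mu>) \<partial>lborel)"
  proof (intro nn_integral_mono_AE)
    from AE_lborel_singleton[of 0]
    show "AE s in lborel. (\<integral>\<^sup>+x. q s x \<partial>\<mu>) \<le> (\<integral>\<^sup>+x. g x \<partial>\<mu>) * indicator {0..t} s"
      by eventually_elim (use subinvariant[of _ g] in \<open>auto simp: q_def indicator_def max_def\<close>)
  qed
  also have "\<dots> = ennreal t * (\<integral>\<^sup>+x. g x \<partial>\<mu>)"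
    using t by (subst nn_integral_cmult) (auto simp: mult.commute)
  finally show ?thesis .
qed

end

locale bounded_below_potential = ultracontractive_process N P X \<mu>
  for N :: "'w measure" and P :: "'m::polish_space \<Rightarrow> 'w measure" and X :: "real \<Rightarrow> 'w \<Rightarrow> 'm"
    and \<mu> :: "'m measure" +
  fixes V :: "'m \<Rightarrow> real" and c :: real
  assumes V [measurable]: "V \<in> borel_measurable borel"
    and lower: "AE x in \<mu>. - c \<le> V x"
begin

abbreviation U :: "real \<Rightarrow> ('m \<Rightarrow> real) \<Rightarrow> 'm \<Rightarrow> real" where
  "U \<equiv> feynman_kac V P X"

lemma AE_fk_weight_le:
  assumes t: "0 \<le> t"
  shows "AE \<omega> in P x. fk_weight V X t \<omega> \<le> exp (c * t)"
  using AE_path[OF lower]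
proof eventually_elim
  case (elim \<omega>)
  show ?case
  proof (cases "set_integrable lborel {0..t} (\<lambda>s. V (X s \<omega>))")
    case True
    have "- c * t = (LINT s:{0..t}|lborel. - c)"
      using t by (simp add: set_lebesgue_integral_def)
    also have "\<dots> \<le> (LINT s:{0..t}|lborel. V (X s \<omega>))"
      unfolding set_lebesgue_integral_def
    proof (rule integral_mono_AE)
      from elim show "AE s in lborel. indicator {0..t} s *\<^sub>R - c \<le> indicator {0..t} s *\<^sub>R V (X s \<omega>)"
        by eventually_elim (auto simp: indicator_def)
    qed (use True t in \<open>auto simp: set_integrable_def\<close>)
    finally show ?thesis
      using True by (simp add: fk_weight_def)
  qed (simp add: fk_weight_def)
qed

lemma ennreal_U_one:
  assumes t: "0 \<le> t"
  shows "ennreal (U t (\<lambda>_. 1) x) = (\<integral>\<^sup>+\<omega>. ennreal (fk_weight V X t \<omega>) \<partial>P x)"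
proof -
  interpret prob_space "P x" by (rule prob_space_P)
  have "integrable (P x) (fk_weight V X t)"
    by (rule integrable_const_bound[where B = "exp (c * t)"]) (use AE_fk_weight_le[OF t] in auto)
  then show ?thesis
    by (subst nn_integral_eq_integral) (auto simp: feynman_kac_def)
qed

section \<open>Pointwise bounds on the Feynman--Kac semigroup\<close>

text \<open>The exit event is in general measurable only after completion, so the estimate is carried out on its main
  part, which has the same probability. There the path stays in the ball during \<open>(0, t)\<close>, and almost
  every time point sees the essential bounds of \<open>V\<close> because the laws are absolutely continuous.\<close>

lemma exit_lower_bound:
  assumes t: "0 < t"
  shows "exp_ereal (- (ereal t * ball_esssup \<mu> V x)) * stay_prob P X t x \<le> ennreal (U t (\<lambda>_. 1) x)"
proof -
  interpret prob_space "P x" by (rule prob_space_P)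
  have ess: "AE y in \<mu>. ereal (indicator (ball x 1) y * max 0 (V y)) \<le> ball_esssup \<mu> V x"
    unfolding ball_esssup_def by (rule esssup_AE)
  have space_P: "space (P x) = space N"
    using sets_P by (rule sets_eq_imp_space_eq)
  show ?thesis
  proof (cases "ball_esssup \<mu> V x")
    case PInf
    then show ?thesis
      using t by (simp add: exp_ereal_def)
  next
    case MInf
    \<comment> \<open>This would make \<open>\<mu>\<close> the zero measure, which dominates no probability law.\<close>
    then have "AE y in \<mu>. False"
      using ess by simp
    from AE_law[OF t this, of x] show ?thesis
      using not_empty by simp
  next
    case (real m)
    have upper: "AE y in \<mu>. y \<in> ball x 1 \<longrightarrow> V y \<le> m"
      using ess by eventually_elim (auto simp: real indicator_def)
    define S where "S = {\<omega> \<in> space (P x). ereal t \<le> exit_time X (ball x 1) \<omega>}"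
    show ?thesis
    proof (cases "S \<in> sets (completion (P x))")
      case False
      \<comment> \<open>The probability of a set outside the completed sigma-algebra is \<open>0\<close> by convention.\<close>
      then have "stay_prob P X t x = 0"
        by (simp add: stay_prob_def S_def[symmetric] emeasure_notin_sets)
      then show ?thesis by simp
    next
      case True
      define E where "E = main_part (P x) S"
      have E [measurable]: "E \<in> sets (P x)"
        using True by (simp add: E_def)
      have "E \<subseteq> S"
        using main_part_null_part_Un[OF True] unfolding E_def by blast
      have stay: "stay_prob P X t x = emeasure (P x) E"
        using True by (simp add: stay_prob_def S_def[symmetric] E_def emeasure_completion)
      have in_ball: "X s \<omega> \<in> ball x 1" if "\<omega> \<in> E" "0 < s" "s < t" for s \<omega>
      proof (rule ccontr)
        assume "X s \<omega> \<notin> ball x 1"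
        then have "exit_time X (ball x 1) \<omega> \<le> ereal s"
          unfolding exit_time_def using that by (intro Inf_lower) auto
        moreover have "ereal t \<le> exit_time X (ball x 1) \<omega>"
          using that(1) \<open>E \<subseteq> S\<close> by (auto simp: S_def)
        ultimately have "ereal t \<le> ereal s"
          by (rule order_trans[rotated])
        then show False
          using that by simp
      qed
      have "AE \<omega> in P x. \<omega> \<in> E \<longrightarrow> exp (- t * m) \<le> fk_weight V X t \<omega>"
        using AE_path[OF lower] AE_path[OF upper] AE_space
      proof eventually_elim
        case (elim \<omega>)
        show ?case
        proof
          assume \<omega>: "\<omega> \<in> E"
          have "\<omega> \<in> space N"
            using elim(3) by (simp add: space_P)
          then have "(\<lambda>s. indicator {0..t} s *\<^sub>R V (X (max 0 s) \<omega>)) \<in> borel_measurable lborel"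
            by measurable
          also have "(\<lambda>s. indicator {0..t} s *\<^sub>R V (X (max 0 s) \<omega>)) = (\<lambda>s. indicator {0..t} s *\<^sub>R V (X s \<omega>))"
            by (auto simp: fun_eq_iff indicator_def max_def)
          finally have meas: "(\<lambda>s. indicator {0..t} s *\<^sub>R V (X s \<omega>)) \<in> borel_measurable lborel" .
          have bounds: "AE s in lborel. s \<in> {0..t} \<longrightarrow> - c \<le> V (X s \<omega>) \<and> V (X s \<omega>) \<le> m"
            using elim(1,2) AE_lborel_singleton[of 0] AE_lborel_singleton[of t]
            by eventually_elim (use in_ball[OF \<omega>] in \<open>auto simp: less_le\<close>)
          have const: "integrable lborel (\<lambda>s. indicator {0..t} s *\<^sub>R b)" for b :: real
            using t by simp
          have int: "integrable lborel (\<lambda>s. indicator {0..t} s *\<^sub>R V (X s \<omega>))"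
          proof (rule Bochner_Integration.integrable_bound[OF const meas])
            show "AE s in lborel. norm (indicator {0..t} s *\<^sub>R V (X s \<omega>))
                \<le> norm (indicator {0..t} s *\<^sub>R (\<bar>c\<bar> + \<bar>m\<bar>))"
              using bounds by eventually_elim (auto simp: indicator_def)
          qed
          have "(LINT s:{0..t}|lborel. V (X s \<omega>)) \<le> (LINT s:{0..t}|lborel. m)"
            unfolding set_lebesgue_integral_def
          proof (rule integral_mono_AE[OF int const])
            show "AE s in lborel. indicator {0..t} s *\<^sub>R V (X s \<omega>) \<le> indicator {0..t} s *\<^sub>R m"
              using bounds by eventually_elim (auto simp: indicator_def)
          qed
          also have "\<dots> = t * m"
            using t by (simp add: set_lebesgue_integral_def)
          finally show "exp (- t * m) \<le> fk_weight V X t \<omega>"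
            using int by (simp add: fk_weight_def set_integrable_def)
        qed
      qed
      then have "(\<integral>\<^sup>+\<omega>. ennreal (exp (- t * m)) * indicator E \<omega> \<partial>P x)
          \<le> (\<integral>\<^sup>+\<omega>. ennreal (fk_weight V X t \<omega>) \<partial>P x)"
        by (intro nn_integral_mono_AE) (auto simp: indicator_def intro: ennreal_leI)
      then show ?thesis
        using t by (simp add: ennreal_U_one stay real exp_ereal_def nn_integral_cmult)
    qed
  qed
qed

lemma ennreal_U_one_le:
  assumes t: "0 < t"
  shows "ennreal (U t (\<lambda>_. 1) x)
    \<le> ennreal (1 / t) * (\<integral>\<^sup>+s\<in>{0..t}. (\<integral>\<^sup>+\<omega>. ennreal (exp (- t * V (X s \<omega>))) \<partial>P x) \<partial>lborel)"
  using nn_integral_fk_weight_le[OF t V] t by (simp add: ennreal_U_one)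

lemma average_upper_bound:
  assumes t: "0 < t"
  shows "U t (\<lambda>_. 1) x
    \<le> 1 / t * (LINT s:{0..t}|lborel. transition_semigroup P X s (\<lambda>y. exp (- t * V y)) x)"
proof -
  interpret prob_space "P x" by (rule prob_space_P)
  define T where "T s = transition_semigroup P X s (\<lambda>y. exp (- t * V y)) x" for s
  have T0: "0 \<le> T s" for s
    by (simp add: T_def transition_semigroup_def)
  have T: "(\<integral>\<^sup>+\<omega>. ennreal (exp (- t * V (X s \<omega>))) \<partial>P x) = ennreal (T s)" "T s \<le> exp (c * t)"
    if s: "0 < s" for s
  proof -
    have [measurable]: "X s \<in> N \<rightarrow>\<^sub>M borel"
      using s by (intro measurable_X) simp
    have bound: "AE \<omega> in P x. exp (- t * V (X s \<omega>)) \<le> exp (c * t)"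
      using AE_law[OF s lower]
    proof eventually_elim
      case (elim \<omega>)
      then have "t * (- c) \<le> t * V (X s \<omega>)"
        using t by (intro mult_left_mono) auto
      then show ?case by (simp add: mult.commute)
    qed
    have int: "integrable (P x) (\<lambda>\<omega>. exp (- t * V (X s \<omega>)))"
      by (rule integrable_const_bound[where B = "exp (c * t)"]) (use bound in auto)
    then show "(\<integral>\<^sup>+\<omega>. ennreal (exp (- t * V (X s \<omega>))) \<partial>P x) = ennreal (T s)"
      unfolding T_def transition_semigroup_def by (intro nn_integral_eq_integral) auto
    show "T s \<le> exp (c * t)"
      unfolding T_def transition_semigroup_def
      using integral_mono_AE[OF int integrable_const[of "exp (c * t)"] bound] by (simp add: prob_space)
  qed
  have eq: "indicator {0..t} s *\<^sub>R T s
      = indicator {0..t} s *\<^sub>R (\<integral>\<omega>. exp (- t * V (X (max 0 s) \<omega>)) \<partial>P x)" for s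
    by (auto simp: T_def transition_semigroup_def indicator_def max_def)
  have meas: "(\<lambda>s. indicator {0..t} s *\<^sub>R T s) \<in> borel_measurable lborel"
    unfolding eq by measurable
  have int: "integrable lborel (\<lambda>s. indicator {0..t} s *\<^sub>R T s)"
  proof (rule Bochner_Integration.integrable_bound[OF _ meas])
    show "integrable lborel (\<lambda>s. indicator {0..t} s *\<^sub>R exp (c * t))"
      using t by simp
    show "AE s in lborel. norm (indicator {0..t} s *\<^sub>R T s) \<le> norm (indicator {0..t} s *\<^sub>R exp (c * t))"
      using AE_lborel_singleton[of 0]
      by eventually_elim (use T(2) T0 in \<open>auto simp: indicator_def\<close>)
  qed
  have "ennreal (U t (\<lambda>_. 1) x)
      \<le> ennreal (1 / t) * (\<integral>\<^sup>+s\<in>{0..t}. (\<integral>\<^sup>+\<omega>. ennreal (exp (- t * V (X s \<omega>))) \<partial>P x) \<partial>lborel)"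
    by (rule ennreal_U_one_le[OF t])
  also have "(\<integral>\<^sup>+s\<in>{0..t}. (\<integral>\<^sup>+\<omega>. ennreal (exp (- t * V (X s \<omega>))) \<partial>P x) \<partial>lborel)
      = (\<integral>\<^sup>+s. ennreal (indicator {0..t} s *\<^sub>R T s) \<partial>lborel)"
  proof (rule nn_integral_cong_AE)
    show "AE s in lborel. (\<integral>\<^sup>+\<omega>. ennreal (exp (- t * V (X s \<omega>))) \<partial>P x) * indicator {0..t} s
        = ennreal (indicator {0..t} s *\<^sub>R T s)"
      using AE_lborel_singleton[of 0]
      by eventually_elim (use T(1) in \<open>auto simp: indicator_def\<close>)
  qed
  also have "\<dots> = ennreal (LINT s:{0..t}|lborel. T s)"
    unfolding set_lebesgue_integral_def using T0 by (intro nn_integral_eq_integral int) auto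
  also have "ennreal (1 / t) * \<dots> = ennreal (1 / t * (LINT s:{0..t}|lborel. T s))"
    using t by (intro ennreal_mult'[symmetric]) auto
  finally show ?thesis
    using t T0 unfolding T_def[symmetric]
    by (subst (asm) ennreal_le_iff) (auto simp: set_lebesgue_integral_def intro!: divide_nonneg_pos integral_nonneg_AE)
qed

end

section \<open>Bounds on the heat content\<close>

text \<open>For \<open>f\<close> measurable this is an equality. For the lower integral of an arbitrary \<open>f\<close> the inequality
  remains, and it is applied to the essential supremum over a ball as a function of the centre.\<close>

lemma nn_integral_cmult_le: "c * (\<integral>\<^sup>+x. f x \<partial>M) \<le> (\<integral>\<^sup>+x. c * f x \<partial>M)"
proof -
  have "c * (\<integral>\<^sup>+x. f x \<partial>M) = (SUP g\<in>{g. simple_function M g \<and> g \<le> f}. c * integral\<^sup>S M g)"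
    unfolding nn_integral_def by (rule SUP_mult_left_ennreal)
  also have "\<dots> \<le> (\<integral>\<^sup>+x. c * f x \<partial>M)"
  proof (rule SUP_least)
    fix g assume "g \<in> {g. simple_function M g \<and> g \<le> f}"
    then have g: "simple_function M g" "g \<le> f" by auto
    have "c * integral\<^sup>S M g = (\<integral>\<^sup>+x. c * g x \<partial>M)"
      using g(1) by (simp add: nn_integral_eq_simple_integral nn_integral_cmult borel_measurable_simple_function)
    also have "\<dots> \<le> (\<integral>\<^sup>+x. c * f x \<partial>M)"
      using g(2) by (intro nn_integral_mono mult_left_mono) (auto simp: le_fun_def)
    finally show "c * integral\<^sup>S M g \<le> (\<integral>\<^sup>+x. c * f x \<partial>M)" .
  qed
  finally show ?thesis .
qed

context bounded_below_potential
begin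

lemma heat_content_lower_bound:
  assumes t: "0 < t"
  shows "(INF x. stay_prob P X t x) * (\<integral>\<^sup>+x. exp_ereal (- (ereal t * ball_esssup \<mu> V x)) \<partial>\<mu>)
    \<le> heat_content \<mu> U t"
proof -
  have "(INF x. stay_prob P X t x) * exp_ereal (- (ereal t * ball_esssup \<mu> V y))
      \<le> ennreal (U t (\<lambda>_. 1) y)" for y
  proof -
    have "(INF x. stay_prob P X t x) * exp_ereal (- (ereal t * ball_esssup \<mu> V y))
        \<le> stay_prob P X t y * exp_ereal (- (ereal t * ball_esssup \<mu> V y))"
      by (intro mult_right_mono INF_lower) auto
    also have "\<dots> \<le> ennreal (U t (\<lambda>_. 1) y)"
      using exit_lower_bound[OF t, of y] by (simp add: mult.commute)
    finally show ?thesis .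
  qed
  then show ?thesis
    unfolding heat_content_def
    by (intro order_trans[OF nn_integral_cmult_le] nn_integral_mono)
qed

text \<open>The pointwise bound is integrated over the starting point, and sub-invariance replaces each
  \<open>\<integral>P\<^sub>s g d\<mu>\<close> by \<open>\<integral>g d\<mu>\<close>.\<close>

lemma heat_content_upper_bound:
  assumes t: "0 < t"
  shows "heat_content \<mu> U t \<le> (\<integral>\<^sup>+x. ennreal (exp (- t * V x)) \<partial>\<mu>)"
proof -
  define g where "g x = ennreal (exp (- t * V x))" for x
  have [measurable]: "g \<in> borel_measurable borel"
    unfolding g_def by measurable
  define H where "H x = (\<integral>\<^sup>+s\<in>{0..t}. (\<integral>\<^sup>+\<omega>. g (X s \<omega>) \<partial>P x) \<partial>lborel)" for x
  have [measurable]: "H \<in> borel_measurable borel"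
    unfolding H_def by (rule measurable_time_average) measurable
  have "heat_content \<mu> U t \<le> (\<integral>\<^sup>+x. ennreal (1 / t) * H x \<partial>\<mu>)"
    unfolding heat_content_def H_def g_def by (intro nn_integral_mono ennreal_U_one_le t)
  also have "\<dots> = ennreal (1 / t) * (\<integral>\<^sup>+x. H x \<partial>\<mu>)"
    by (rule nn_integral_cmult) measurable
  also have "\<dots> \<le> ennreal (1 / t) * (ennreal t * (\<integral>\<^sup>+x. g x \<partial>\<mu>))"
    unfolding H_def by (intro mult_left_mono averaged_subinvariance t) auto
  also have "\<dots> = (\<integral>\<^sup>+x. g x \<partial>\<mu>)"
    using t by (simp add: mult.assoc[symmetric] ennreal_mult[symmetric])
  finally show ?thesis
    by (simp add: g_def)
qed

section \<open>Compactness of the Feynman--Kac operators\<close>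

lemma measurable_X_pos: "0 < t \<Longrightarrow> X t \<in> P x \<rightarrow>\<^sub>M borel"
  using measurable_X[of t] by (simp add: measurable_cong_sets[OF sets_P refl])

lemma U_bounded:
  assumes t: "0 < t"
  obtains K where "0 \<le> K"
    "\<And>x f. f \<in> L2 \<mu> \<Longrightarrow> (\<integral>\<^sup>+\<omega>. ennreal \<bar>fk_weight V X t \<omega> * f (X t \<omega>)\<bar> \<partial>P x) \<le> ennreal (K * L2_norm \<mu> f)"
proof -
  obtain K where K: "\<And>x f. f \<in> L2 \<mu> \<Longrightarrow> (\<integral>\<^sup>+\<omega>. ennreal \<bar>f (X t \<omega>)\<bar> \<partial>P x) \<le> ennreal (K * L2_norm \<mu> f)"
    using ultracontractive[OF t] by blast
  show ?thesis
  proof (rule that)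
    show "0 \<le> exp (c * t) * max 0 K"
      by simp
    fix x f assume f: "f \<in> L2 \<mu>"
    have [measurable]: "f \<in> borel_measurable borel"
      using f by (simp add: L2_def)
    note [measurable] = measurable_X_pos[OF t]
    have "(\<integral>\<^sup>+\<omega>. ennreal \<bar>fk_weight V X t \<omega> * f (X t \<omega>)\<bar> \<partial>P x)
        \<le> (\<integral>\<^sup>+\<omega>. ennreal (exp (c * t)) * ennreal \<bar>f (X t \<omega>)\<bar> \<partial>P x)"
    proof (rule nn_integral_mono_AE)
      show "AE \<omega> in P x. ennreal \<bar>fk_weight V X t \<omega> * f (X t \<omega>)\<bar> \<le> ennreal (exp (c * t)) * ennreal \<bar>f (X t \<omega>)\<bar>"
        using AE_fk_weight_le[OF less_imp_le[OF t]]
        by eventually_elim (simp add: abs_mult ennreal_mult[symmetric] mult_right_mono)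
    qed
    also have "\<dots> = ennreal (exp (c * t)) * (\<integral>\<^sup>+\<omega>. ennreal \<bar>f (X t \<omega>)\<bar> \<partial>P x)"
      by (rule nn_integral_cmult) measurable
    also have "\<dots> \<le> ennreal (exp (c * t)) * ennreal (max 0 K * L2_norm \<mu> f)"
      by (intro mult_left_mono order_trans[OF K[OF f]] ennreal_leI mult_right_mono) auto
    also have "\<dots> = ennreal (exp (c * t) * max 0 K * L2_norm \<mu> f)"
      by (simp add: ennreal_mult[symmetric] mult.assoc)
    finally show "(\<integral>\<^sup>+\<omega>. ennreal \<bar>fk_weight V X t \<omega> * f (X t \<omega>)\<bar> \<partial>P x)
        \<le> ennreal (exp (c * t) * max 0 K * L2_norm \<mu> f)" .
  qed
qed

lemma U_integrable:
  assumes t: "0 < t" and f: "f \<in> L2 \<mu>"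
  shows "integrable (P x) (\<lambda>\<omega>. fk_weight V X t \<omega> * f (X t \<omega>))"
proof -
  obtain K where K: "(\<integral>\<^sup>+\<omega>. ennreal \<bar>fk_weight V X t \<omega> * f (X t \<omega>)\<bar> \<partial>P x) \<le> ennreal (K * L2_norm \<mu> f)"
    using U_bounded[OF t] f by metis
  note [measurable] = measurable_X_pos[OF t]
  have [measurable]: "f \<in> borel_measurable borel"
    using f by (simp add: L2_def)
  show ?thesis
    unfolding integrable_iff_bounded using K by (auto intro: le_less_trans)
qed

lemma U_uniform_bound:
  assumes t: "0 < t"
  obtains K where "0 \<le> K" "\<And>x f. f \<in> L2 \<mu> \<Longrightarrow> \<bar>U t f x\<bar> \<le> K * L2_norm \<mu> f"
proof -
  obtain K where K0: "0 \<le> K" and K: "\<And>x f. f \<in> L2 \<mu> \<Longrightarrow>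
      (\<integral>\<^sup>+\<omega>. ennreal \<bar>fk_weight V X t \<omega> * f (X t \<omega>)\<bar> \<partial>P x) \<le> ennreal (K * L2_norm \<mu> f)"
    using U_bounded[OF t] by metis
  show ?thesis
  proof (rule that[OF K0])
    fix x f assume f: "f \<in> L2 \<mu>"
    have "ennreal (\<integral>\<omega>. \<bar>fk_weight V X t \<omega> * f (X t \<omega>)\<bar> \<partial>P x) \<le> ennreal (K * L2_norm \<mu> f)"
      using K[OF f, of x] U_integrable[OF t f, of x] by (subst (asm) nn_integral_eq_integral) auto
    then have "(\<integral>\<omega>. \<bar>fk_weight V X t \<omega> * f (X t \<omega>)\<bar> \<partial>P x) \<le> K * L2_norm \<mu> f"
      using K0 by simp
    then show "\<bar>U t f x\<bar> \<le> K * L2_norm \<mu> f"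
      using integral_abs_bound[of "P x" "\<lambda>\<omega>. fk_weight V X t \<omega> * f (X t \<omega>)"]
      unfolding feynman_kac_def by linarith
  qed
qed

text \<open>The weighted law of \<open>X t\<close> has a density with respect to \<open>\<mu>\<close>; boundedness of the functional
  \<open>f \<mapsto> U t f x\<close> on \<open>L\<^sup>2\<close> puts this density into \<open>L\<^sup>2\<close>.\<close>

lemma U_kernel:
  assumes t: "0 < t"
  obtains k where "k \<in> L2 \<mu>" "\<And>f. f \<in> L2 \<mu> \<Longrightarrow> U t f x = (\<integral>y. k y * f y \<partial>\<mu>)"
proof -
  note [measurable] = measurable_X_pos[OF t]
  define \<nu> where "\<nu> = distr (density (P x) (\<lambda>\<omega>. ennreal (fk_weight V X t \<omega>))) \<mu> (X t)"
  have X_\<mu> [measurable]: "X t \<in> density (P x) (\<lambda>\<omega>. ennreal (fk_weight V X t \<omega>)) \<rightarrow>\<^sub>M \<mu>"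
    by measurable
  have \<nu>: "integral\<^sup>N \<nu> g = (\<integral>\<^sup>+\<omega>. ennreal (fk_weight V X t \<omega>) * g (X t \<omega>) \<partial>P x)"
    if [measurable]: "g \<in> borel_measurable borel" for g :: "'m \<Rightarrow> ennreal"
    unfolding \<nu>_def by (subst nn_integral_distr, simp, simp, subst nn_integral_density) auto
  have "emeasure \<nu> (space \<nu>) = (\<integral>\<^sup>+\<omega>. ennreal (fk_weight V X t \<omega>) \<partial>P x)"
    using \<nu>[of "\<lambda>_. 1"] by simp
  also have "\<dots> = ennreal (U t (\<lambda>_. 1) x)"
    using t by (simp add: ennreal_U_one)
  finally have "finite_measure \<nu>"
    by (intro finite_measureI) simp
  moreover have "absolutely_continuous \<mu> \<nu>"
    unfolding absolutely_continuous_def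
  proof
    fix A assume A: "A \<in> null_sets \<mu>"
    then have [measurable]: "A \<in> sets borel"
      by (auto simp: sets_\<mu> null_sets_def)
    have "emeasure \<nu> A = (\<integral>\<^sup>+y. indicator A y \<partial>\<nu>)"
      by (simp add: \<nu>_def sets_\<mu>)
    also have "\<dots> = (\<integral>\<^sup>+\<omega>. ennreal (fk_weight V X t \<omega>) * indicator A (X t \<omega>) \<partial>P x)"
      by (rule \<nu>) simp
    also have "\<dots> = (\<integral>\<^sup>+\<omega>. 0 \<partial>P x)"
    proof (rule nn_integral_cong_AE)
      show "AE \<omega> in P x. ennreal (fk_weight V X t \<omega>) * indicator A (X t \<omega>) = 0"
        using AE_law[OF t AE_not_in[OF A]] by eventually_elim simp
    qed
    finally show "A \<in> null_sets \<nu>"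
      by (simp add: null_sets_def \<nu>_def sets_\<mu>)
  qed
  moreover have "sets \<nu> = sets \<mu>"
    by (simp add: \<nu>_def)
  ultimately obtain D where D [measurable]: "D \<in> borel_measurable \<mu>"
    and RN: "AE y in \<mu>. RN_deriv \<mu> \<nu> y = ennreal (D y)" and D0: "\<And>y. 0 \<le> D y"
    using real_RN_deriv[of \<nu>] by metis
  have "\<nu> = density \<mu> (RN_deriv \<mu> \<nu>)"
    using \<open>absolutely_continuous \<mu> \<nu>\<close> \<open>sets \<nu> = sets \<mu>\<close> by (rule density_RN_deriv[symmetric])
  also have "\<dots> = density \<mu> (\<lambda>y. ennreal (D y))"
    using RN by (intro density_cong) auto
  finally have dens: "\<nu> = density \<mu> (\<lambda>y. ennreal (D y))" .
  obtain K where K0: "0 \<le> K" and K: "\<And>f. f \<in> L2 \<mu> \<Longrightarrow>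
      (\<integral>\<^sup>+\<omega>. ennreal \<bar>fk_weight V X t \<omega> * f (X t \<omega>)\<bar> \<partial>P x) \<le> ennreal (K * L2_norm \<mu> f)"
    using U_bounded[OF t] by metis
  have "D \<in> L2 \<mu>"
  proof (rule L2_if_bounded_functional[OF D D0 K0])
    fix f :: "'m \<Rightarrow> real" assume f: "f \<in> L2 \<mu>" and f0: "\<And>y. 0 \<le> f y"
    have [measurable]: "f \<in> borel_measurable borel"
      using f by (simp add: L2_def)
    have "(\<integral>\<^sup>+y. ennreal (D y * f y) \<partial>\<mu>) = (\<integral>\<^sup>+y. ennreal (f y) \<partial>\<nu>)"
      unfolding dens using D0 f0 by (subst nn_integral_density) (auto simp: ennreal_mult)
    also have "\<dots> = (\<integral>\<^sup>+\<omega>. ennreal \<bar>fk_weight V X t \<omega> * f (X t \<omega>)\<bar> \<partial>P x)"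
      using f0 by (subst \<nu>) (auto simp: ennreal_mult abs_mult)
    also have "\<dots> \<le> ennreal (K * L2_norm \<mu> f)"
      by (rule K[OF f])
    finally show "(\<integral>\<^sup>+y. ennreal (D y * f y) \<partial>\<mu>) \<le> ennreal (K * L2_norm \<mu> f)" .
  qed
  moreover have "U t f x = (\<integral>y. D y * f y \<partial>\<mu>)" if f: "f \<in> L2 \<mu>" for f
  proof -
    have [measurable]: "f \<in> borel_measurable borel"
      using f by (simp add: L2_def)
    have "U t f x = (\<integral>\<omega>. f (X t \<omega>) \<partial>density (P x) (\<lambda>\<omega>. ennreal (fk_weight V X t \<omega>)))"
      unfolding feynman_kac_def by (subst integral_density) auto
    also have "\<dots> = (\<integral>y. f y \<partial>\<nu>)"
      unfolding \<nu>_def by (subst integral_distr) auto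
    also have "\<dots> = (\<integral>y. D y * f y \<partial>\<mu>)"
      unfolding dens using D0 by (subst integral_density) auto
    finally show ?thesis .
  qed
  ultimately show ?thesis
    by (rule that)
qed

text \<open>Cauchy--Schwarz under \<open>P x\<close> separates the weight from \<open>f\<close>; after integration over \<open>x\<close>,
  sub-invariance controls the second factor by \<open>\<parallel>f\<parallel>\<^sup>2\<close>.\<close>

lemma U_square_le:
  assumes t: "0 < t" and f: "f \<in> L2 \<mu>"
  shows "ennreal ((U t f x)\<^sup>2)
    \<le> (\<integral>\<^sup>+\<omega>. ennreal ((fk_weight V X t \<omega>)\<^sup>2) \<partial>P x) * (\<integral>\<^sup>+\<omega>. ennreal ((f (X t \<omega>))\<^sup>2) \<partial>P x)"
proof -
  note [measurable] = measurable_X_pos[OF t]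
  have [measurable]: "f \<in> borel_measurable borel"
    using f by (simp add: L2_def)
  have "ennreal \<bar>U t f x\<bar> \<le> ennreal (\<integral>\<omega>. \<bar>fk_weight V X t \<omega> * f (X t \<omega>)\<bar> \<partial>P x)"
    unfolding feynman_kac_def by (intro ennreal_leI integral_abs_bound)
  also have "\<dots> = (\<integral>\<^sup>+\<omega>. ennreal (fk_weight V X t \<omega>) * ennreal \<bar>f (X t \<omega>)\<bar> \<partial>P x)"
    by (subst nn_integral_eq_integral[OF integrable_abs[OF U_integrable[OF t f]], symmetric])
      (auto simp: abs_mult ennreal_mult)
  finally have "(ennreal \<bar>U t f x\<bar>)\<^sup>2 \<le> (\<integral>\<^sup>+\<omega>. ennreal (fk_weight V X t \<omega>) * ennreal \<bar>f (X t \<omega>)\<bar> \<partial>P x)\<^sup>2"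
    by (intro power_mono_ennreal)
  also have "\<dots> \<le> (\<integral>\<^sup>+\<omega>. (ennreal (fk_weight V X t \<omega>))\<^sup>2 \<partial>P x) * (\<integral>\<^sup>+\<omega>. (ennreal \<bar>f (X t \<omega>)\<bar>)\<^sup>2 \<partial>P x)"
    by (rule Cauchy_Schwarz_nn_integral) auto
  finally show ?thesis
    by (simp add: ennreal_power)
qed

lemma U_tail_le:
  assumes t: "0 < t" and f: "f \<in> L2 \<mu>" and B: "B \<in> sets borel"
    and small: "\<And>x. x \<in> B \<Longrightarrow> (\<integral>\<^sup>+\<omega>. ennreal ((fk_weight V X t \<omega>)\<^sup>2) \<partial>P x) \<le> ennreal \<epsilon>"
  shows "(\<integral>\<^sup>+x\<in>B. ennreal ((U t f x)\<^sup>2) \<partial>\<mu>) \<le> ennreal \<epsilon> * ennreal ((L2_norm \<mu> f)\<^sup>2)"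
proof -
  have [measurable]: "f \<in> borel_measurable borel"
    using f by (simp add: L2_def)
  have [measurable]: "X t \<in> N \<rightarrow>\<^sub>M borel"
    using t by (intro measurable_X) simp
  have [measurable]: "(\<lambda>x. \<integral>\<^sup>+\<omega>. ennreal ((f (X t \<omega>))\<^sup>2) \<partial>P x) \<in> borel_measurable borel"
    by (rule measurable_compose[OF kernel_subprob nn_integral_measurable_subprob_algebra]) measurable
  have "(\<integral>\<^sup>+x\<in>B. ennreal ((U t f x)\<^sup>2) \<partial>\<mu>)
      \<le> (\<integral>\<^sup>+x. ennreal \<epsilon> * (\<integral>\<^sup>+\<omega>. ennreal ((f (X t \<omega>))\<^sup>2) \<partial>P x) \<partial>\<mu>)"
  proof (intro nn_integral_mono)
    fix x
    show "ennreal ((U t f x)\<^sup>2) * indicator B x \<le> ennreal \<epsilon> * (\<integral>\<^sup>+\<omega>. ennreal ((f (X t \<omega>))\<^sup>2) \<partial>P x)"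
      using order_trans[OF U_square_le[OF t f] mult_right_mono[OF small]] by (cases "x \<in> B") auto
  qed
  also have "\<dots> = ennreal \<epsilon> * (\<integral>\<^sup>+x. (\<integral>\<^sup>+\<omega>. ennreal ((f (X t \<omega>))\<^sup>2) \<partial>P x) \<partial>\<mu>)"
    by (rule nn_integral_cmult) measurable
  also have "\<dots> \<le> ennreal \<epsilon> * (\<integral>\<^sup>+x. ennreal ((f x)\<^sup>2) \<partial>\<mu>)"
    by (intro mult_left_mono subinvariant t) auto
  finally show ?thesis
    using f by (simp add: nn_integral_square_L2)
qed

lemma U_L2:
  assumes t: "0 < t" and f: "f \<in> L2 \<mu>"
  shows "U t f \<in> L2 \<mu>"
proof -
  have "(\<integral>\<^sup>+x\<in>UNIV. ennreal ((U t f x)\<^sup>2) \<partial>\<mu>) \<le> ennreal ((exp (c * t))\<^sup>2) * ennreal ((L2_norm \<mu> f)\<^sup>2)"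
  proof (rule U_tail_le[OF t f])
    fix x
    interpret prob_space "P x" by (rule prob_space_P)
    have "(\<integral>\<^sup>+\<omega>. ennreal ((fk_weight V X t \<omega>)\<^sup>2) \<partial>P x) \<le> (\<integral>\<^sup>+\<omega>. ennreal ((exp (c * t))\<^sup>2) \<partial>P x)"
    proof (rule nn_integral_mono_AE)
      show "AE \<omega> in P x. ennreal ((fk_weight V X t \<omega>)\<^sup>2) \<le> ennreal ((exp (c * t))\<^sup>2)"
        using AE_fk_weight_le[OF less_imp_le[OF t]]
        by eventually_elim (intro ennreal_leI power_mono, auto)
    qed
    also have "\<dots> = ennreal ((exp (c * t))\<^sup>2)"
      by (simp add: emeasure_space_1)
    finally show "(\<integral>\<^sup>+\<omega>. ennreal ((fk_weight V X t \<omega>)\<^sup>2) \<partial>P x) \<le> ennreal ((exp (c * t))\<^sup>2)" .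
  qed simp
  also have "\<dots> < \<infinity>"
    by (simp add: ennreal_mult_less_top)
  finally have "(\<integral>\<^sup>+x. ennreal ((U t f x)\<^sup>2) \<partial>\<mu>) < \<infinity>"
    by simp
  moreover have "U t f \<in> borel_measurable borel"
    using f t by (intro borel_measurable_feynman_kac V) (auto simp: L2_def)
  ultimately show ?thesis
    by (simp add: L2_iff_nn_integral)
qed

text \<open>The second moment of the weight is a Feynman--Kac expectation for \<open>2 V\<close>, so it is at most the
  time average of \<open>P\<^sub>s g\<close> with \<open>g = exp (- 2 t V)\<close>. The part of \<open>g\<close> on a high superlevel set of \<open>V\<close> is
  uniformly small; the part on the sublevel set is \<open>\<mu>\<close>-integrable, and so is its average, which is
  therefore small off a set of finite measure.\<close>

lemma weight_small_off_finite_measure: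
  assumes t: "0 < t" and level: "\<And>b. emeasure \<mu> {x. V x < b} < \<infinity>" and \<epsilon>: "0 < \<epsilon>"
  obtains A where "A \<in> sets borel" "emeasure \<mu> A < \<infinity>"
    "\<And>x. x \<notin> A \<Longrightarrow> (\<integral>\<^sup>+\<omega>. ennreal ((fk_weight V X t \<omega>)\<^sup>2) \<partial>P x) \<le> ennreal \<epsilon>"
proof -
  \<comment> \<open>The level at which \<open>exp (- 2 t b) = \<epsilon> / 2\<close>.\<close>
  define b where "b = - ln (\<epsilon> / 2) / (2 * t)"
  define g where "g x = ennreal (exp (- t * (2 * V x))) * indicator {x. V x < b} x" for x
  have [measurable]: "g \<in> borel_measurable borel"
    unfolding g_def by measurable
  have g_split: "ennreal (exp (- t * (2 * V x))) \<le> g x + ennreal (\<epsilon> / 2)" for x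
  proof (cases "V x < b")
    case False
    then have "- t * (2 * V x) \<le> ln (\<epsilon> / 2)"
      using t by (simp add: b_def field_simps)
    then have "exp (- t * (2 * V x)) \<le> \<epsilon> / 2"
      using \<epsilon> by (metis exp_le_cancel_iff exp_ln half_gt_zero)
    then show ?thesis
      using False by (auto simp: g_def intro: ennreal_leI)
  qed (simp add: g_def)
  have "(\<integral>\<^sup>+x. g x \<partial>\<mu>) \<le> (\<integral>\<^sup>+x. ennreal (exp (2 * c * t)) * indicator {x. V x < b} x \<partial>\<mu>)"
  proof (rule nn_integral_mono_AE)
    show "AE x in \<mu>. g x \<le> ennreal (exp (2 * c * t)) * indicator {x. V x < b} x"
      using lower
    proof eventually_elim
      case (elim x)
      then have "t * (2 * (- c)) \<le> t * (2 * V x)"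
        using t by (intro mult_left_mono) auto
      then show ?case
        by (auto simp: g_def indicator_def mult.commute mult.left_commute intro!: ennreal_leI)
    qed
  qed
  also have "\<dots> < \<infinity>"
    using level[of b] by (subst nn_integral_cmult) (auto simp: sets_\<mu> ennreal_mult_less_top)
  finally have g_fin: "(\<integral>\<^sup>+x. g x \<partial>\<mu>) < \<infinity>" .
  define H where "H x = (\<integral>\<^sup>+s\<in>{0..t}. (\<integral>\<^sup>+\<omega>. g (X s \<omega>) \<partial>P x) \<partial>lborel)" for x
  have [measurable]: "H \<in> borel_measurable borel"
    unfolding H_def by (rule measurable_time_average) measurable
  have H_clip: "H x = (\<integral>\<^sup>+s. (\<integral>\<^sup>+\<omega>. g (X (max 0 s) \<omega>) \<partial>P x) * indicator {0..t} s \<partial>lborel)" for x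
    unfolding H_def by (intro nn_integral_cong) (auto simp: indicator_def max_def)
  have H_fin: "(\<integral>\<^sup>+x. H x \<partial>\<mu>) < \<infinity>"
    using averaged_subinvariance[OF t, of g] g_fin unfolding H_def
    by (auto intro: le_less_trans simp: ennreal_mult_less_top)
  define A where "A = {x. ennreal (t * (\<epsilon> / 2)) \<le> H x}"
  have [measurable]: "A \<in> sets borel"
    unfolding A_def by measurable
  have "ennreal (t * (\<epsilon> / 2)) * emeasure \<mu> A = (\<integral>\<^sup>+x. ennreal (t * (\<epsilon> / 2)) * indicator A x \<partial>\<mu>)"
    by (simp add: nn_integral_cmult sets_\<mu>)
  also have "\<dots> \<le> (\<integral>\<^sup>+x. H x \<partial>\<mu>)"
    by (intro nn_integral_mono) (auto simp: A_def indicator_def)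
  finally have "ennreal (t * (\<epsilon> / 2)) * emeasure \<mu> A < \<infinity>"
    using H_fin by (rule le_less_trans)
  then have A_fin: "emeasure \<mu> A < \<infinity>"
    using t \<epsilon> by (auto simp: ennreal_mult_less_top)
  show ?thesis
  proof (rule that[OF _ A_fin])
    fix x assume "x \<notin> A"
    interpret prob_space "P x" by (rule prob_space_P)
    have "(\<integral>\<^sup>+\<omega>. ennreal ((fk_weight V X t \<omega>)\<^sup>2) \<partial>P x)
        \<le> ennreal (1 / t) * (\<integral>\<^sup>+s\<in>{0..t}. (\<integral>\<^sup>+\<omega>. ennreal (exp (- t * (2 * V (X s \<omega>)))) \<partial>P x) \<partial>lborel)"
      unfolding fk_weight_power2 by (rule nn_integral_fk_weight_le[OF t]) measurable
    also have "(\<integral>\<^sup>+s\<in>{0..t}. (\<integral>\<^sup>+\<omega>. ennreal (exp (- t * (2 * V (X s \<omega>)))) \<partial>P x) \<partial>lborel)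
        \<le> (\<integral>\<^sup>+s. (\<integral>\<^sup>+\<omega>. g (X (max 0 s) \<omega>) \<partial>P x) * indicator {0..t} s + ennreal (\<epsilon> / 2) * indicator {0..t} s \<partial>lborel)"
    proof (intro nn_integral_mono)
      fix s
      have "(\<integral>\<^sup>+\<omega>. ennreal (exp (- t * (2 * V (X s \<omega>)))) \<partial>P x)
          \<le> (\<integral>\<^sup>+\<omega>. g (X s \<omega>) \<partial>P x) + ennreal (\<epsilon> / 2)" if "0 \<le> s"
      proof -
        have [measurable]: "X s \<in> N \<rightarrow>\<^sub>M borel"
          using that by (rule measurable_X)
        have "(\<integral>\<^sup>+\<omega>. ennreal (exp (- t * (2 * V (X s \<omega>)))) \<partial>P x) \<le> (\<integral>\<^sup>+\<omega>. g (X s \<omega>) + ennreal (\<epsilon> / 2) \<partial>P x)"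
          by (intro nn_integral_mono g_split)
        also have "\<dots> = (\<integral>\<^sup>+\<omega>. g (X s \<omega>) \<partial>P x) + ennreal (\<epsilon> / 2)"
          by (subst nn_integral_add) (auto simp: emeasure_space_1)
        finally show ?thesis .
      qed
      then show "(\<integral>\<^sup>+\<omega>. ennreal (exp (- t * (2 * V (X s \<omega>)))) \<partial>P x) * indicator {0..t} s
          \<le> (\<integral>\<^sup>+\<omega>. g (X (max 0 s) \<omega>) \<partial>P x) * indicator {0..t} s + ennreal (\<epsilon> / 2) * indicator {0..t} s"
        by (auto simp: indicator_def max_def)
    qed
    also have "\<dots> = H x + ennreal (\<epsilon> / 2) * ennreal t"
      using t by (subst nn_integral_add) (auto simp: H_clip nn_integral_cmult)
    also have "\<dots> \<le> ennreal (t * (\<epsilon> / 2)) + ennreal (\<epsilon> / 2) * ennreal t"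
      using \<open>x \<notin> A\<close> by (intro add_mono) (auto simp: A_def)
    also have "\<dots> = ennreal (t * \<epsilon>)"
      using t \<epsilon> by (simp add: ennreal_mult[symmetric] ennreal_plus[symmetric] field_simps del: ennreal_plus)
    also have "ennreal (1 / t) * ennreal (t * \<epsilon>) = ennreal \<epsilon>"
      using t \<epsilon> by (subst ennreal_mult[symmetric]) auto
    finally show "(\<integral>\<^sup>+\<omega>. ennreal ((fk_weight V X t \<omega>)\<^sup>2) \<partial>P x) \<le> ennreal \<epsilon>"
      by (auto simp: mult_left_mono)
  qed simp
qed

text \<open>A weakly convergent subsequence of a bounded sequence is mapped by the \<open>L\<^sup>2\<close> kernels to a sequence
  that converges at every point; it is uniformly bounded, and its tails are uniformly small because the
  weight is small off a set of finite measure.\<close>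

lemma compact_U:
  assumes t: "0 < t" and level: "\<And>b. emeasure \<mu> {x. V x < b} < \<infinity>"
  shows "compact_operator_L2 \<mu> (U t)"
  unfolding compact_operator_L2_def
proof (intro conjI ballI allI impI)
  show "U t f \<in> L2 \<mu>" if "f \<in> L2 \<mu>" for f
    by (rule U_L2[OF t that])
next
  fix f g assume eq: "AE x in \<mu>. f x = g x" and f: "f \<in> L2 \<mu>" and g: "g \<in> L2 \<mu>"
  have "U t f x = U t g x" for x
    unfolding feynman_kac_def
  proof (rule integral_cong_AE)
    show "AE \<omega> in P x. fk_weight V X t \<omega> * f (X t \<omega>) = fk_weight V X t \<omega> * g (X t \<omega>)"
      using AE_law[OF t eq] by eventually_elim simp
  qed (use U_integrable[OF t f] U_integrable[OF t g] in auto)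
  then show "AE x in \<mu>. U t f x = U t g x"
    by simp
next
  fix f g and a b :: real assume f: "f \<in> L2 \<mu>" and g: "g \<in> L2 \<mu>"
  have "U t (\<lambda>y. a * f y + b * g y) x = a * U t f x + b * U t g x" for x
  proof -
    have "U t (\<lambda>y. a * f y + b * g y) x
        = (\<integral>\<omega>. a * (fk_weight V X t \<omega> * f (X t \<omega>)) + b * (fk_weight V X t \<omega> * g (X t \<omega>)) \<partial>P x)"
      unfolding feynman_kac_def by (simp add: algebra_simps)
    also have "\<dots> = a * U t f x + b * U t g x"
      using U_integrable[OF t f, of x] U_integrable[OF t g, of x]
      by (simp add: feynman_kac_def)
    finally show ?thesis .
  qed
  then show "AE x in \<mu>. U t (\<lambda>y. a * f y + b * g y) x = a * U t f x + b * U t g x"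
    by simp
next
  fix F :: "nat \<Rightarrow> 'm \<Rightarrow> real"
  assume "(\<forall>n. F n \<in> L2 \<mu>) \<and> (\<exists>C. \<forall>n. L2_norm \<mu> (F n) \<le> C)"
  then obtain C where F: "\<And>n. F n \<in> L2 \<mu>" and C: "\<And>n. L2_norm \<mu> (F n) \<le> C"
    by auto
  have C0: "0 \<le> C"
    using C[of 0] L2_norm_nonneg[of \<mu> "F 0"] by linarith
  obtain r :: "nat \<Rightarrow> nat" where r: "strict_mono r"
    and weak: "\<And>k. k \<in> L2 \<mu> \<Longrightarrow> convergent (\<lambda>n. \<integral>x. k x * F (r n) x \<partial>\<mu>)"
    by (rule L2_bounded_subsequence_weakly_convergent[OF F C]) (rule that)
  have "convergent (\<lambda>n. U t (F (r n)) x)" for x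
  proof -
    obtain k where "k \<in> L2 \<mu>" "\<And>f. f \<in> L2 \<mu> \<Longrightarrow> U t f x = (\<integral>y. k y * f y \<partial>\<mu>)"
      by (rule U_kernel[OF t, of x]) (rule that)
    then show ?thesis
      using weak[of k] F by simp
  qed
  then obtain g where g: "\<And>x. (\<lambda>n. U t (F (r n)) x) \<longlonglongrightarrow> g x"
    unfolding convergent_def by metis
  obtain K where K0: "0 \<le> K" and K: "\<And>x f. f \<in> L2 \<mu> \<Longrightarrow> \<bar>U t f x\<bar> \<le> K * L2_norm \<mu> f"
    using U_uniform_bound[OF t] by metis
  have L2: "U t (F (r n)) \<in> L2 \<mu>" for n
    by (rule U_L2[OF t F])
  have bound: "\<bar>U t (F (r n)) x\<bar> \<le> K * C" for n x
    using K[OF F, of "r n" x] mult_left_mono[OF C[of "r n"] K0] by linarith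
  have tails: "\<exists>A\<in>sets \<mu>. emeasure \<mu> A < \<infinity> \<and>
      (\<forall>n. (\<integral>\<^sup>+x\<in>-A. ennreal ((U t (F (r n)) x)\<^sup>2) \<partial>\<mu>) \<le> ennreal \<epsilon>)" if \<epsilon>: "0 < \<epsilon>" for \<epsilon>
  proof -
    have "0 < \<epsilon> / (C\<^sup>2 + 1)"
      using \<epsilon> by (intro divide_pos_pos add_nonneg_pos) auto
    from weight_small_off_finite_measure[OF t level this] obtain A where
      A: "A \<in> sets borel" "emeasure \<mu> A < \<infinity>" and
      small: "\<And>x. x \<notin> A \<Longrightarrow> (\<integral>\<^sup>+\<omega>. ennreal ((fk_weight V X t \<omega>)\<^sup>2) \<partial>P x) \<le> ennreal (\<epsilon> / (C\<^sup>2 + 1))"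
      by metis
    have "(\<integral>\<^sup>+x\<in>-A. ennreal ((U t (F (r n)) x)\<^sup>2) \<partial>\<mu>) \<le> ennreal \<epsilon>" for n
    proof -
      have "(\<integral>\<^sup>+x\<in>-A. ennreal ((U t (F (r n)) x)\<^sup>2) \<partial>\<mu>)
          \<le> ennreal (\<epsilon> / (C\<^sup>2 + 1)) * ennreal ((L2_norm \<mu> (F (r n)))\<^sup>2)"
        using A small by (intro U_tail_le[OF t F]) auto
      also have "\<dots> \<le> ennreal (\<epsilon> / (C\<^sup>2 + 1)) * ennreal (C\<^sup>2 + 1)"
        by (intro mult_left_mono ennreal_leI order_trans[OF power_mono[OF C]]) auto
      also have "\<dots> = ennreal \<epsilon>"
        using \<epsilon> by (subst ennreal_mult[symmetric]) (auto simp: add_nonneg_eq_0_iff)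
      finally show ?thesis .
    qed
    then show ?thesis
      using A by (intro bexI[of _ A]) (auto simp: sets_\<mu>)
  qed
  note L2_convergence_uniform_tails[OF L2 bound g tails]
  with r show "\<exists>r g. strict_mono r \<and> g \<in> L2 \<mu> \<and> (\<lambda>n. L2_norm \<mu> (\<lambda>x. U t (F (r n)) x - g x)) \<longlonglongrightarrow> 0"
    by (intro exI[of _ r] exI[of _ g]) simp
qed

end

section \<open>Deriving ultracontractivity and sub-invariance from the hypotheses\<close>

lemma sigma_finite_if_locally_finite:
  fixes \<mu> :: "'m::polish_space measure"
  assumes sets: "sets \<mu> = sets borel"
    and fin: "\<And>x. \<exists>U. open U \<and> x \<in> U \<and> emeasure \<mu> U < \<infinity>"
  shows "sigma_finite_measure \<mu>"
proof -
  have "\<And>S. S \<in> {U. open U \<and> emeasure \<mu> U < \<infinity>} \<Longrightarrow> open S"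
    by simp
  then obtain F where F: "F \<subseteq> {U. open U \<and> emeasure \<mu> U < \<infinity>}" "countable F"
    "\<Union>F = \<Union>{U. open U \<and> emeasure \<mu> U < \<infinity>}"
    by (rule Lindelof)
  have "\<Union>F = UNIV"
    using F(3) fin by blast
  then show ?thesis
    using F(1,2) sets sets_eq_imp_space_eq[OF sets]
    by (intro sigma_finite_measure.intro exI[of _ F]) (auto simp: less_top)
qed

lemma measurable_process_if_markov_process: "markov_process N P X \<Longrightarrow> measurable_process N P X"
  by (simp add: markov_process_def measurable_process_def)

text \<open>The almost everywhere bound from \<open>L\<^sup>2\<close> to \<open>L\<^sup>\<infinity>\<close> holds at every point for bounded \<open>f\<close>, because
  \<open>P\<^sub>t f\<close> is then continuous and \<open>\<mu>\<close> charges every nonempty open set. Monotone convergence removes the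
  boundedness of \<open>f\<close>.\<close>

lemma ultracontractive_everywhere:
  fixes \<mu> :: "'m::polish_space measure"
  assumes "measurable_process N P X" and ref: "reference_measure \<mu>"
    and sf: "strong_feller \<mu> (transition_semigroup P X)"
    and bd: "L2_Linf_bounded \<mu> (transition_semigroup P X)" and t: "0 < t"
  shows "\<exists>K. \<forall>x. \<forall>f\<in>L2 \<mu>. (\<integral>\<^sup>+\<omega>. ennreal \<bar>f (X t \<omega>)\<bar> \<partial>P x) \<le> ennreal (K * L2_norm \<mu> f)"
proof -
  interpret measurable_process N P X by fact
  have sets_\<mu>: "sets \<mu> = sets borel"
    and full: "\<And>U. open U \<Longrightarrow> U \<noteq> {} \<Longrightarrow> 0 < emeasure \<mu> U"
    using ref by (auto simp: reference_measure_def)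
  obtain K where K: "\<And>f. f \<in> L2 \<mu> \<Longrightarrow>
      AE x in \<mu>. \<bar>transition_semigroup P X t f x\<bar> \<le> K * L2_norm \<mu> f"
    using bd t unfolding L2_Linf_bounded_def by blast
  have [measurable]: "X t \<in> P x \<rightarrow>\<^sub>M borel" for x
    using measurable_X[of t] t by (simp add: measurable_cong_sets[OF sets_P refl])
  have bounded_case: "(\<integral>\<^sup>+\<omega>. ennreal (f (X t \<omega>)) \<partial>P x) \<le> ennreal (K * L2_norm \<mu> f)"
    if f: "f \<in> L2 \<mu>" and f0: "\<And>y. 0 \<le> f y" and fb: "\<And>y. f y \<le> b" for f b x
  proof -
    interpret prob_space "P x" by (rule prob_space_P)
    have [measurable]: "f \<in> borel_measurable borel"
      using f measurable_cong_sets[OF sets_\<mu> refl] by (auto simp: L2_def)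
    define T where "T = transition_semigroup P X t f"
    have "f \<in> Linf \<mu>"
      using f f0 fb by (auto simp: Linf_def L2_def intro!: exI[of _ b])
    then have cont: "continuous_on UNIV T"
      using sf t by (auto simp: strong_feller_def C_bounded_def T_def)
    define O1 where "O1 = {y. K * L2_norm \<mu> f < T y}"
    have "open O1"
      unfolding O1_def by (intro open_Collect_less continuous_on_const cont)
    moreover have "emeasure \<mu> O1 = 0"
    proof -
      have "AE y in \<mu>. y \<notin> O1"
        using K[OF f] by eventually_elim (auto simp: O1_def T_def)
      then show ?thesis
        using \<open>open O1\<close> by (subst (asm) AE_iff_measurable[of O1])
          (auto simp: sets_\<mu> sets_eq_imp_space_eq[OF sets_\<mu>])
    qed
    ultimately have "O1 = {}"
      using full[of O1] by auto
    then have le: "T x \<le> K * L2_norm \<mu> f"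
      by (auto simp: O1_def not_less)
    have "integrable (P x) (\<lambda>\<omega>. f (X t \<omega>))"
      by (rule integrable_const_bound[where B = b]) (use f0 fb in auto)
    then have "(\<integral>\<^sup>+\<omega>. ennreal (f (X t \<omega>)) \<partial>P x) = ennreal (T x)"
      unfolding T_def transition_semigroup_def using f0 by (intro nn_integral_eq_integral) auto
    then show ?thesis
      using le by (simp add: ennreal_leI)
  qed
  have "(\<integral>\<^sup>+\<omega>. ennreal \<bar>f (X t \<omega>)\<bar> \<partial>P x) \<le> ennreal (max 0 K * L2_norm \<mu> f)" if f: "f \<in> L2 \<mu>" for f x
  proof -
    have [measurable]: "f \<in> borel_measurable borel"
      using f measurable_cong_sets[OF sets_\<mu> refl] by (auto simp: L2_def)
    define h where "h n y = min \<bar>f y\<bar> (real n)" for n y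
    have h_meas: "h n \<in> borel_measurable \<mu>" for n
      unfolding h_def using f by (auto simp: L2_def)
    have h_L2: "h n \<in> L2 \<mu>" "L2_norm \<mu> (h n) \<le> L2_norm \<mu> f" for n
      using L2_dominated[OF f h_meas[of n]] by (auto simp: h_def)
    have "(\<integral>\<^sup>+\<omega>. ennreal \<bar>f (X t \<omega>)\<bar> \<partial>P x) \<le> (\<integral>\<^sup>+\<omega>. liminf (\<lambda>n. ennreal (h n (X t \<omega>))) \<partial>P x)"
    proof (intro nn_integral_mono)
      fix \<omega>
      obtain j where "\<bar>f (X t \<omega>)\<bar> \<le> real j"
        using real_arch_simple by blast
      then have "eventually (\<lambda>n. ennreal (h n (X t \<omega>)) = ennreal \<bar>f (X t \<omega>)\<bar>) sequentially"
        unfolding eventually_sequentially by (intro exI[of _ j]) (auto simp: h_def min_def)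
      then have "(\<lambda>n. ennreal (h n (X t \<omega>))) \<longlonglongrightarrow> ennreal \<bar>f (X t \<omega>)\<bar>"
        by (rule tendsto_eventually)
      then show "ennreal \<bar>f (X t \<omega>)\<bar> \<le> liminf (\<lambda>n. ennreal (h n (X t \<omega>)))"
        using lim_imp_Liminf[OF trivial_limit_sequentially] by (metis order_refl)
    qed
    also have "\<dots> \<le> liminf (\<lambda>n. \<integral>\<^sup>+\<omega>. ennreal (h n (X t \<omega>)) \<partial>P x)"
      by (rule nn_integral_liminf) (simp add: h_def)
    also have "\<dots> \<le> ennreal (max 0 K * L2_norm \<mu> f)"
    proof (intro Liminf_le always_eventually allI)
      fix n
      have "(\<integral>\<^sup>+\<omega>. ennreal (h n (X t \<omega>)) \<partial>P x) \<le> ennreal (K * L2_norm \<mu> (h n))"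
        by (rule bounded_case[OF h_L2(1), of _ "real n"]) (auto simp: h_def)
      also have "\<dots> \<le> ennreal (max 0 K * L2_norm \<mu> f)"
        by (intro ennreal_leI mult_mono h_L2) auto
      finally show "(\<integral>\<^sup>+\<omega>. ennreal (h n (X t \<omega>)) \<partial>P x) \<le> ennreal (max 0 K * L2_norm \<mu> f)" .
    qed simp
    finally show ?thesis .
  qed
  then show ?thesis by blast
qed

text \<open>Duality applied to the indicator \<open>f\<close> of a set \<open>A\<close> of finite measure gives \<open>\<integral>\<^sub>A P\<^sub>s g d\<mu> \<le> \<integral>g d\<mu>\<close> for
  bounded \<open>g\<close> supported in such a set, since the dual semigroup maps \<open>f\<close> to a function with values in
  \<open>[0, 1]\<close>. Monotone limits along an exhaustion give the general case.\<close>

lemma subinvariant_if_dual: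
  fixes \<mu> :: "'m::polish_space measure" and g :: "'m \<Rightarrow> ennreal"
  assumes "measurable_process N P X" and "measurable_process Nh Ph Xh"
    and sets_\<mu> [measurable_cong]: "sets \<mu> = sets borel" and "sigma_finite_measure \<mu>"
    and dual: "semigroups_in_duality \<mu> (transition_semigroup P X) (transition_semigroup Ph Xh)"
    and s: "0 < s" and g [measurable]: "g \<in> borel_measurable borel"
  shows "(\<integral>\<^sup>+x. (\<integral>\<^sup>+\<omega>. g (X s \<omega>) \<partial>P x) \<partial>\<mu>) \<le> (\<integral>\<^sup>+x. g x \<partial>\<mu>)"
proof -
  interpret X: measurable_process N P X by fact
  interpret Xh: measurable_process Nh Ph Xh by fact
  interpret \<mu>: sigma_finite_measure \<mu> by fact
  have [measurable]: "X s \<in> N \<rightarrow>\<^sub>M borel" "Xh s \<in> Nh \<rightarrow>\<^sub>M borel"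
    using s by (auto intro: X.measurable_X Xh.measurable_X)
  obtain A :: "nat \<Rightarrow> 'm set" where A: "range A \<subseteq> sets \<mu>" "(\<Union>i. A i) = space \<mu>"
    "\<And>i. emeasure \<mu> (A i) \<noteq> \<infinity>" "incseq A"
    using \<mu>.sigma_finite_incseq by blast
  have A_meas [measurable]: "A n \<in> sets borel" for n
    using A(1) sets_\<mu> by auto
  have A_fin: "emeasure \<mu> (A n) < \<infinity>" for n
    using A(3)[of n] by (simp add: less_top)
  have in_A: "eventually (\<lambda>n. y \<in> A n) sequentially" for y
  proof -
    have "y \<in> (\<Union>i. A i)"
      using A(2) sets_eq_imp_space_eq[OF sets_\<mu>] by auto
    then obtain i where "y \<in> A i" by auto
    then show ?thesis
      unfolding eventually_sequentially using incseqD[OF A(4)] by blast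
  qed
  define h where "h n y = enn2real (min (g y) (of_nat n)) * indicator (A n) y" for n y
  have [measurable]: "h n \<in> borel_measurable borel" for n
    unfolding h_def by measurable
  have h0: "0 \<le> h n y" for n y
    by (simp add: h_def)
  have h_enn: "ennreal (h n y) = min (g y) (of_nat n) * indicator (A n) y" for n y
    by (auto simp: h_def indicator_def ennreal_enn2real_if min_def top_unique ennreal_of_nat_eq_real_of_nat)
  have hn: "h n y \<le> real n * indicator (A n) y" for n y
  proof -
    have "ennreal (h n y) \<le> ennreal (real n * indicator (A n) y)"
      by (auto simp: h_enn indicator_def ennreal_of_nat_eq_real_of_nat)
    then show ?thesis by simp
  qed
  have ind_int: "integrable \<mu> (\<lambda>y. b * indicator (A n) y)" for n and b :: real
    using A_fin[of n] by (intro integrable_mult_right) (simp add: sets_\<mu>)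
  have ind_L2: "indicator (A n) \<in> L2 \<mu>" for n
  proof -
    have "(\<lambda>x. (indicator (A n) x)\<^sup>2) = (indicator (A n) :: _ \<Rightarrow> real)"
      by (auto simp: indicator_def)
    then show ?thesis
      using ind_int[of 1 n] by (simp add: L2_def)
  qed
  have h_L2: "h n \<in> L2 \<mu>" for n
  proof (rule L2_dominated(1))
    show "(\<lambda>y. real n * indicator (A n) y + 0 * indicator (A n) y) \<in> L2 \<mu>"
      by (intro L2_lincomb ind_L2)
    show "\<bar>h n x\<bar> \<le> \<bar>real n * indicator (A n) x + 0 * indicator (A n) x\<bar>" for x
      using h0[of n x] hn[of n x] by simp
  qed simp
  define T where "T n = transition_semigroup P X s (h n)" for n
  define Th where "Th n = transition_semigroup Ph Xh s (indicator (A n))" for n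
  have T: "(\<integral>\<^sup>+\<omega>. ennreal (h n (X s \<omega>)) \<partial>P x) = ennreal (T n x)" "0 \<le> T n x" "T n x \<le> real n" for n x
  proof -
    interpret prob_space "P x" by (rule X.prob_space_P)
    have le: "h n y \<le> real n" for y
      using hn[of n y] by (cases "y \<in> A n") auto
    have int: "integrable (P x) (\<lambda>\<omega>. h n (X s \<omega>))"
      by (rule integrable_const_bound[where B = "real n"]) (use h0 le in auto)
    then show "(\<integral>\<^sup>+\<omega>. ennreal (h n (X s \<omega>)) \<partial>P x) = ennreal (T n x)"
      unfolding T_def transition_semigroup_def using h0 by (intro nn_integral_eq_integral) auto
    show "0 \<le> T n x"
      unfolding T_def transition_semigroup_def using h0 by simp
    show "T n x \<le> real n"
      unfolding T_def transition_semigroup_def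
      using integral_mono[OF int integrable_const[of "real n"]] le by (simp add: prob_space)
  qed
  have T_meas [measurable]: "T n \<in> borel_measurable borel" for n
    unfolding T_def transition_semigroup_def[abs_def]
    by (rule measurable_compose[OF X.kernel_subprob integral_measurable_subprob_algebra]) measurable
  have Th: "0 \<le> Th n x" "Th n x \<le> 1" for n x
  proof -
    interpret prob_space "Ph x" by (rule Xh.prob_space_P)
    have "integrable (Ph x) (\<lambda>\<omega>. indicator (A n) (Xh s \<omega>) :: real)"
      by (rule integrable_const_bound[where B = 1]) auto
    from integral_mono[OF this integrable_const[of 1]] show "Th n x \<le> 1"
      unfolding Th_def transition_semigroup_def by (simp add: prob_space)
  qed (simp add: Th_def transition_semigroup_def)
  have Th_meas [measurable]: "Th n \<in> borel_measurable borel" for n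
    unfolding Th_def transition_semigroup_def[abs_def]
    by (rule measurable_compose[OF Xh.kernel_subprob integral_measurable_subprob_algebra]) measurable
  have step: "(\<integral>\<^sup>+x. ennreal (indicator (A n) x * T n x) \<partial>\<mu>) \<le> (\<integral>\<^sup>+x. g x \<partial>\<mu>)" for n
  proof -
    have int1: "integrable \<mu> (\<lambda>x. indicator (A n) x * T n x)"
      by (rule Bochner_Integration.integrable_bound[OF ind_int[of "real n" n]])
        (use T in \<open>auto simp: indicator_def\<close>)
    have int_h: "integrable \<mu> (h n)"
      by (rule Bochner_Integration.integrable_bound[OF ind_int[of "real n" n]])
        (use h0 hn in auto)
    have int2: "integrable \<mu> (\<lambda>x. Th n x * h n x)"
      by (rule Bochner_Integration.integrable_bound[OF int_h])
        (use Th h0 in \<open>auto simp: abs_mult intro!: mult_left_le_one_le\<close>)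
    have "(\<integral>\<^sup>+x. ennreal (indicator (A n) x * T n x) \<partial>\<mu>) = ennreal (\<integral>x. indicator (A n) x * T n x \<partial>\<mu>)"
      using T by (intro nn_integral_eq_integral int1) auto
    also have "(\<integral>x. indicator (A n) x * T n x \<partial>\<mu>) = (\<integral>x. Th n x * h n x \<partial>\<mu>)"
      using dual s ind_L2[of n] h_L2[of n] unfolding semigroups_in_duality_def T_def Th_def by blast
    also have "ennreal \<dots> = (\<integral>\<^sup>+x. ennreal (Th n x * h n x) \<partial>\<mu>)"
      using Th h0 by (intro nn_integral_eq_integral[symmetric] int2) auto
    also have "\<dots> \<le> (\<integral>\<^sup>+x. g x \<partial>\<mu>)"
    proof (intro nn_integral_mono)
      fix x
      have "ennreal (Th n x * h n x) \<le> ennreal (h n x)"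
        using Th[of n x] h0[of n x] by (intro ennreal_leI mult_left_le_one_le) auto
      also have "\<dots> \<le> g x"
        by (auto simp: h_enn indicator_def)
      finally show "ennreal (Th n x * h n x) \<le> g x" .
    qed
    finally show ?thesis .
  qed
  have h_lim: "(\<lambda>n. ennreal (h n y)) \<longlonglongrightarrow> g y" for y
  proof -
    have "(\<lambda>n. min (g y) (of_nat n)) \<longlonglongrightarrow> min (g y) top"
      by (intro tendsto_min tendsto_const of_nat_tendsto_top_ennreal)
    then have "(\<lambda>n. min (g y) (of_nat n)) \<longlonglongrightarrow> g y"
      by simp
    then show ?thesis
      by (rule Lim_transform_eventually) (use in_A[of y] in \<open>auto elim!: eventually_mono simp: h_enn\<close>)
  qed
  have "(\<integral>\<^sup>+x. (\<integral>\<^sup>+\<omega>. g (X s \<omega>) \<partial>P x) \<partial>\<mu>) \<le> (\<integral>\<^sup>+x. liminf (\<lambda>n. ennreal (indicator (A n) x * T n x)) \<partial>\<mu>)"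
  proof (intro nn_integral_mono)
    fix x
    have "(\<integral>\<^sup>+\<omega>. g (X s \<omega>) \<partial>P x) = (\<integral>\<^sup>+\<omega>. liminf (\<lambda>n. ennreal (h n (X s \<omega>))) \<partial>P x)"
      using lim_imp_Liminf[OF trivial_limit_sequentially h_lim] by simp
    also have "\<dots> \<le> liminf (\<lambda>n. \<integral>\<^sup>+\<omega>. ennreal (h n (X s \<omega>)) \<partial>P x)"
      by (rule nn_integral_liminf) measurable
    also have "\<dots> \<le> liminf (\<lambda>n. ennreal (indicator (A n) x * T n x))"
      by (rule Liminf_mono) (use in_A[of x] in \<open>auto elim!: eventually_mono simp: T(1)\<close>)
    finally show "(\<integral>\<^sup>+\<omega>. g (X s \<omega>) \<partial>P x) \<le> liminf (\<lambda>n. ennreal (indicator (A n) x * T n x))" .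
  qed
  also have "\<dots> \<le> liminf (\<lambda>n. \<integral>\<^sup>+x. ennreal (indicator (A n) x * T n x) \<partial>\<mu>)"
    by (rule nn_integral_liminf) measurable
  also have "\<dots> \<le> (\<integral>\<^sup>+x. g x \<partial>\<mu>)"
    using step by (intro Liminf_le) auto
  finally show ?thesis .
qed

lemma semigroups_in_duality_sym:
  "semigroups_in_duality \<mu> T Th \<Longrightarrow> semigroups_in_duality \<mu> Th T"
  unfolding semigroups_in_duality_def by (simp add: mult.commute)

lemma bounded_below_potential_if_dual:
  fixes \<mu> :: "'m::polish_space measure"
  assumes ref: "reference_measure \<mu>"
    and "markov_process N P X" "markov_process Nh Ph Xh"
    and "strong_feller \<mu> (transition_semigroup P X)"
    and "L2_Linf_bounded \<mu> (transition_semigroup P X)"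
    and "semigroups_in_duality \<mu> (transition_semigroup P X) (transition_semigroup Ph Xh)"
    and V: "V \<in> borel_measurable borel" "AE x in \<mu>. - c \<le> V x"
  shows "bounded_below_potential N P X \<mu> V c"
proof -
  note X = assms(2,3)[THEN measurable_process_if_markov_process]
  have sets: "sets \<mu> = sets borel"
    using ref by (simp add: reference_measure_def)
  have sigma: "sigma_finite_measure \<mu>"
    using ref by (intro sigma_finite_if_locally_finite) (auto simp: reference_measure_def)
  interpret measurable_process N P X
    by (rule X)
  show ?thesis
  proof (unfold_locales, goal_cases)
    case 1 show ?case by (rule sets)
  next
    case 2 show ?case
      using sigma by (rule sigma_finite_measure.sigma_finite_countable)
  next
    case (3 t) then show ?case
      by (rule ultracontractive_everywhere[OF X(1) ref assms(4,5)])
  next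
    case (4 s g) then show ?case
      by (rule subinvariant_if_dual[OF X sets sigma assms(6)])
  qed (use V in auto)
qed

section \<open>The two processes together\<close>

theorem lemma7p2:
  fixes \<mu> :: "'m::polish_space measure"
    and N :: "'w measure" and P :: "'m \<Rightarrow> 'w measure" and X :: "real \<Rightarrow> 'w \<Rightarrow> 'm"
    and Nh :: "'v measure" and Ph :: "'m \<Rightarrow> 'v measure" and Xh :: "real \<Rightarrow> 'v \<Rightarrow> 'm"
    and V :: "'m \<Rightarrow> real"
  assumes "locally_compact_space (euclidean :: 'm topology)"
    and "\<not> bounded (UNIV :: 'm set)"
    and "reference_measure \<mu>"
    and "markov_process N P X" and "markov_process Nh Ph Xh"
    and "L2_contractive \<mu> (transition_semigroup P X)" and "L2_contractive \<mu> (transition_semigroup Ph Xh)"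
    and "feller (transition_semigroup P X)" and "feller (transition_semigroup Ph Xh)"
    and "strong_feller \<mu> (transition_semigroup P X)" and "strong_feller \<mu> (transition_semigroup Ph Xh)"
    and "resolvents_in_weak_duality \<mu> P X Ph Xh"
    and "semigroups_in_duality \<mu> (transition_semigroup P X) (transition_semigroup Ph Xh)"
    and "positivity_improving \<mu> (transition_semigroup P X)" and "positivity_improving \<mu> (transition_semigroup Ph Xh)"
    and "L2_Linf_bounded \<mu> (transition_semigroup P X)" and "L2_Linf_bounded \<mu> (transition_semigroup Ph Xh)"
    and "V \<in> borel_measurable borel"
    and "(\<lambda>x. max 0 (V x)) \<in> Linf_loc \<mu>"
    and "(\<lambda>x. max 0 (- V x)) \<in> Linf \<mu>"
  defines "U \<equiv> feynman_kac V P X" and "Uh \<equiv> feynman_kac V Ph Xh"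
  defines "Z \<equiv> heat_content \<mu> U"
  shows
    "(\<forall>x. \<forall>t>0.
        exp_ereal (- (ereal t * ball_esssup \<mu> V x)) * stay_prob P X t x
          \<le> ennreal (U t (\<lambda>_. 1) x) \<and>
        U t (\<lambda>_. 1) x
          \<le> 1 / t * (LINT s:{0..t}|lborel. transition_semigroup P X s (\<lambda>y. exp (- t * V y)) x)) \<and>
     (\<forall>x. \<forall>t>0.
        exp_ereal (- (ereal t * ball_esssup \<mu> V x)) * stay_prob Ph Xh t x
          \<le> ennreal (Uh t (\<lambda>_. 1) x) \<and>
        Uh t (\<lambda>_. 1) x
          \<le> 1 / t * (LINT s:{0..t}|lborel. transition_semigroup Ph Xh s (\<lambda>y. exp (- t * V y)) x)) \<and>
     (\<forall>t>0.
        (INF x. stay_prob P X t x) * (\<integral>\<^sup>+x. exp_ereal (- (ereal t * ball_esssup \<mu> V x)) \<partial>\<mu>)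
          \<le> Z t \<and>
        Z t \<le> (\<integral>\<^sup>+x. ennreal (exp (- t * V x)) \<partial>\<mu>)) \<and>
     ((\<forall>x r. emeasure \<mu> (ball x r) < \<infinity>) \<longrightarrow>
        (\<exists>x\<^sub>0. filterlim V at_top (filtercomap (\<lambda>x. dist x x\<^sub>0) at_top)) \<longrightarrow>
        (\<forall>t>0. compact_operator_L2 \<mu> (U t) \<and> compact_operator_L2 \<mu> (Uh t))) \<and>
     (\<forall>t>0.
        ((\<integral>\<^sup>+x. ennreal (exp (- t * V x)) \<partial>\<mu>) < \<infinity> \<longrightarrow> Z t < \<infinity>) \<and>
        ((INF x. stay_prob P X t x) > 0 \<longrightarrow> Z t < \<infinity> \<longrightarrow>
          (\<integral>\<^sup>+x. exp_ereal (- (ereal t * ball_esssup \<mu> V x)) \<partial>\<mu>) < \<infinity>))"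
proof -
  obtain C where "AE x in \<mu>. \<bar>max 0 (- V x)\<bar> \<le> C"
    using assms(20) by (auto simp: Linf_def)
  then have below: "AE x in \<mu>. - C \<le> V x"
    by eventually_elim linarith
  \<comment> \<open>The hypotheses are symmetric under exchanging the two processes.\<close>
  interpret fwd: bounded_below_potential N P X \<mu> V C
    by (rule bounded_below_potential_if_dual[OF assms(3,4,5,10,16,13,18) below])
  interpret bwd: bounded_below_potential Nh Ph Xh \<mu> V C
    by (rule bounded_below_potential_if_dual[OF assms(3,5,4,11,17) semigroups_in_duality_sym[OF assms(13)]
          assms(18) below])
  \<comment> \<open>A potential tending to infinity is at least \<open>b\<close> outside some ball.\<close>
  have level: "emeasure \<mu> {x. V x < b} < \<infinity>"
    if balls: "\<forall>x r. emeasure \<mu> (ball x r) < \<infinity>"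
      and lim: "\<exists>x\<^sub>0. filterlim V at_top (filtercomap (\<lambda>x. dist x x\<^sub>0) at_top)" for b
  proof -
    obtain x0 where "filterlim V at_top (filtercomap (\<lambda>x. dist x x0) at_top)"
      using lim by blast
    then have "eventually (\<lambda>x. b \<le> V x) (filtercomap (\<lambda>x. dist x x0) at_top)"
      by (simp add: filterlim_at_top)
    then obtain R where R: "\<And>x. R \<le> dist x x0 \<Longrightarrow> b \<le> V x"
      unfolding eventually_filtercomap eventually_at_top_linorder by metis
    have "{x. V x < b} \<subseteq> ball x0 R"
      using R by (force simp: dist_commute not_le[symmetric])
    then have "emeasure \<mu> {x. V x < b} \<le> emeasure \<mu> (ball x0 R)"
      by (rule emeasure_mono) (simp add: fwd.sets_\<mu>)
    then show ?thesis
      using balls by (auto intro: le_less_trans)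
  qed
  have finite: "(\<integral>\<^sup>+x. exp_ereal (- (ereal t * ball_esssup \<mu> V x)) \<partial>\<mu>) < \<infinity>"
    if "0 < t" "0 < (INF x. stay_prob P X t x)" "Z t < \<infinity>" for t
  proof -
    have "(INF x. stay_prob P X t x) * (\<integral>\<^sup>+x. exp_ereal (- (ereal t * ball_esssup \<mu> V x)) \<partial>\<mu>) < \<infinity>"
      using fwd.heat_content_lower_bound[OF that(1)] that(3) unfolding Z_def U_def by (rule le_less_trans)
    then show ?thesis
      using that(2) by (auto simp: ennreal_mult_less_top)
  qed
  show ?thesis
    unfolding U_def Uh_def Z_def
    by (intro conjI allI impI)
      (assumption | rule fwd.exit_lower_bound bwd.exit_lower_bound fwd.average_upper_bound
        bwd.average_upper_bound fwd.heat_content_lower_bound fwd.heat_content_upper_bound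
        fwd.compact_U bwd.compact_U level le_less_trans[OF fwd.heat_content_upper_bound]
        finite[unfolded Z_def U_def])+
qed

end
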